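(* Let $X_1,\ldots,X_n$ be i.i.d. from $P_{\theta_0}$ and let $\bar X_n=n^{-1}\sum_{i=1}^n X_i$. Assume that the cumulant generating function $\psi(t)=\log\mathbb E_{\theta_0}[e^{tX_1}]$ exists in a neighbourhood of the origin. Let $\sigma^2=\psi''(0)=\operatorname{Var}_{\theta_0}(X_1)\in(0,\infty)$ and $\lambda_n=a\sqrt{(\log n)/n}$ with $a>0$ fixed. Then $$\mathbb P_{\theta_0}\bigl(|\bar X_n-\theta_0|>\lambda_n\bigr)=\frac{2\sigma}{\sqrt{2\pi n}\,\lambda_n}\exp\Bigl(-\frac{n\lambda_n^2}{2\sigma^2}\Bigr)(1+o(1))=\frac{\sqrt2\,\sigma}{a\sqrt{\pi\log n}}\,n^{-a^2/(2\sigma^2)}(1+o(1)),$$ as $n\to\infty$, uniformly over $a$ in compact subsets of $(0,\infty)$.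
   Context: $\{P_\theta:\theta\in\Theta\}$, with $\Theta\subset\mathbb R$, is a family of distributions on the real line with densities $f(x\mid\theta)$, and $\theta_0\in\Theta$ is a fixed (null) parameter value. $\mathbb P_\theta$ and $\mathbb E_\theta$ refer to the sampling distribution $P_\theta^n$ of the i.i.d. sample $X_1,\ldots,X_n$, and $\operatorname{Var}_{\theta_0}$ is the variance under $\theta_0$. In the displayed formula, $\pi$ is the number $3.14159\ldots$.
   Formalization: The formal statement adds the assumption that the mean of X_1 under P_{θ_0} equals θ_0; without it the claim is false, since the probability on the left would tend to 1 while the right side tends to 0. *)

theory Defs
  imports "HOL-Probability.Probability"
begin

text \<open>
  A family of distributions on the real line, indexed by a set of real parameters, with
  densities with respect to a common dominating measure. Lebesgue densities are the
  special case \<open>\<mu> = lborel\<close>.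
\<close>

locale density_family = sigma_finite_measure \<mu>
  for \<mu> :: "real measure" +
  fixes \<Theta> :: "real set"
    and f :: "real \<Rightarrow> real \<Rightarrow> real"
    and P :: "real \<Rightarrow> real measure"
  assumes sets_dominating: "sets \<mu> = sets borel"
    and density_measurable: "\<theta> \<in> \<Theta> \<Longrightarrow> f \<theta> \<in> borel_measurable \<mu>"
    and density_nonneg: "\<theta> \<in> \<Theta> \<Longrightarrow> 0 \<le> f \<theta> x"
    and P_eq_density: "\<theta> \<in> \<Theta> \<Longrightarrow> P \<theta> = density \<mu> (\<lambda>x. ennreal (f \<theta> x))"
    and prob_space_P: "\<theta> \<in> \<Theta> \<Longrightarrow> prob_space (P \<theta>)"

text \<open>The law of an i.i.d. sample of size \<open>n\<close> from \<open>D\<close>; the coordinates are the observations.\<close>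

definition sample_distr :: "nat \<Rightarrow> real measure \<Rightarrow> (nat \<Rightarrow> real) measure" where
  "sample_distr n D = PiM {1..n} (\<lambda>_. D)"

definition sample_mean :: "nat \<Rightarrow> (nat \<Rightarrow> real) \<Rightarrow> real" where
  "sample_mean n X = (\<Sum>i=1..n. X i) / real n"

definition cgf :: "real measure \<Rightarrow> real \<Rightarrow> real" where
  "cgf D t = ln (prob_space.expectation D (\<lambda>x. exp (t * x)))"

text \<open>
  The Bochner integral is 0 on non-integrable functions, so the existence of the cumulant
  generating function near the origin has to be stated through integrability.
\<close>

definition cgf_exists_near_0 :: "real measure \<Rightarrow> bool" where
  "cgf_exists_near_0 D \<longleftrightarrow> (\<forall>\<^sub>F t in nhds 0. integrable D (\<lambda>x. exp (t * x)))"

definition threshold :: "real \<Rightarrow> nat \<Rightarrow> real" where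
  "threshold a n = a * sqrt (ln (real n) / real n)"

text \<open>Error terms \<open>\<epsilon> n a\<close> that are \<open>o(1)\<close> uniformly over \<open>a\<close> in compact subsets of \<open>(0, \<infinity>)\<close>.\<close>

definition locally_uniform_o1 :: "(nat \<Rightarrow> real \<Rightarrow> real) \<Rightarrow> bool" where
  "locally_uniform_o1 \<epsilon> \<longleftrightarrow>
     (\<forall>K. compact K \<and> K \<subseteq> {0<..} \<longrightarrow> uniform_limit K \<epsilon> (\<lambda>_. 0) sequentially)"

end

theory Submission
  imports Defs "HOL-Real_Asymp.Real_Asymp"
begin

text \<open>
  The events \<open>|mean - \<theta>\<^sub>0| > \<lambda>\<^sub>n\<close> have probability of polynomial order (up to logarithms) \<open>n powr (- a\<^sup>2 / (2 \<sigma>\<^sup>2))\<close>, which for large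
  \<open>a\<close> is far below the additive error of the central limit theorem or of a Berry-Esseen bound. As in Cramer's theory of
  moderate deviations, the law of the observations is tilted exponentially until the threshold
  becomes the mean. Let \<open>Y\<close> be a centred observation with log-mgf \<open>K\<close> and variance \<open>\<sigma>\<^sup>2\<close>, let \<open>t\<close> solve
  \<open>K'(t) = \<lambda>\<close>, and let \<open>s\<^sup>2 = K''(t)\<close> be the tilted variance. If \<open>W\<close> is the standardized sum under the
  law with density \<open>exp (t Y - K(t))\<close>, then exactly (\<open>upper_tail_tilted\<close>)

  \<open>P(Y\<^sub>1 + ... + Y\<^sub>n > n \<lambda>) = exp (- n (t \<lambda> - K(t))) E[exp (- y W); W > 0]\<close> with \<open>y = t s \<surd>n\<close>.

  The first factor is \<open>exp (- n \<lambda>\<^sup>2 / (2 \<sigma>\<^sup>2))\<close> up to \<open>exp O(n \<lambda>\<^sup>3)\<close>, by a Taylor expansion of \<open>K\<close>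
  (\<open>cumulant_expansion\<close>). In the second factor \<open>W\<close> is nearly standard normal, and for a normal \<open>W\<close> the
  expectation is \<open>(1 + o(1)) / (y \<surd>(2 \<pi>))\<close> because \<open>y \<rightarrow> \<infinity>\<close> (\<open>exp_tail_normal\<close>). Replacing \<open>W\<close> by a
  normal variable costs at most twice the Kolmogorov distance (\<open>exp_tail_cdf_perturbation\<close>), which is
  negligible as soon as it is \<open>o(1 / y)\<close>. Since \<open>y\<close> is only of order \<open>\<surd>(log n)\<close>, any polynomial rate in
  the central limit theorem is enough; the rate \<open>n\<^bsup>-1/8\<^esup>\<close> follows from Lindeberg's replacement
  method with a smooth cutoff (\<open>polynomial_Berry_Esseen\<close>).

  The two tails of the sample mean are the upper tails of \<open>X - \<theta>\<^sub>0\<close> and \<open>\<theta>\<^sub>0 - X\<close>. The one-sided result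
  (\<open>moderate_deviation_upper_tail\<close>) is about an arbitrary sequence of thresholds with
  \<open>\<lambda>\<^sub>n \<surd>n \<rightarrow> \<infinity>\<close> and \<open>\<lambda>\<^sub>n n\<^bsup>3/8\<^esup> \<rightarrow> 0\<close>. That gives uniformity over compact sets at once: uniform convergence on
  \<open>K\<close> is convergence along every sequence \<open>a\<^sub>n \<in> K\<close>. The two displayed main terms are equal for
  \<open>n \<ge> 2\<close>, so a single error term serves for both.
\<close>

section \<open>Tilting and averaging over product measures\<close>

text \<open>
  This makes tilting compatible with sampling: tilting each observation is the same as tilting the
  joint law by the product of the weights. Both sides are \<open>\<sigma>\<close>-finite, and on a box the product
  integrates factor by factor.
\<close>

lemma PiM_density:
  assumes fin: "finite I"
    and M: "product_sigma_finite M"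
    and D: "product_sigma_finite (\<lambda>i. density (M i) (w i))"
    and [measurable]: "\<And>i. w i \<in> borel_measurable (M i)"
  shows "PiM I (\<lambda>i. density (M i) (w i)) = density (PiM I M) (\<lambda>\<omega>. \<Prod>i\<in>I. w i (\<omega> i))"
proof -
  interpret M: product_sigma_finite M by (rule M)
  interpret D: product_sigma_finite "\<lambda>i. density (M i) (w i)" by (rule D)
  show ?thesis
  proof (rule D.PiM_eqI[symmetric])
    show "finite I" by (rule fin)
    show "sets (density (PiM I M) (\<lambda>\<omega>. \<Prod>i\<in>I. w i (\<omega> i))) = sets (PiM I (\<lambda>i. density (M i) (w i)))"
      by (auto intro!: sets_PiM_cong)
    fix A assume A: "\<And>i. i \<in> I \<Longrightarrow> A i \<in> sets (density (M i) (w i))"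
    then have [measurable]: "\<And>i. i \<in> I \<Longrightarrow> A i \<in> sets (M i)" by simp
    have box: "Pi\<^sub>E I A \<in> sets (PiM I M)"
      using fin A by (intro sets_PiM_I_finite) auto
    have "emeasure (density (PiM I M) (\<lambda>\<omega>. \<Prod>i\<in>I. w i (\<omega> i))) (Pi\<^sub>E I A)
        = (\<integral>\<^sup>+\<omega>. (\<Prod>i\<in>I. w i (\<omega> i)) * indicator (Pi\<^sub>E I A) \<omega> \<partial>PiM I M)"
      using box by (subst emeasure_density) auto
    also have "\<dots> = (\<integral>\<^sup>+\<omega>. (\<Prod>i\<in>I. w i (\<omega> i) * indicator (A i) (\<omega> i)) \<partial>PiM I M)"
    proof (intro nn_integral_cong)
      fix \<omega> assume "\<omega> \<in> space (PiM I M)"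
      then have "\<omega> \<in> extensional I" by (auto simp: space_PiM PiE_def)
      then have "indicator (Pi\<^sub>E I A) \<omega> = (\<Prod>i\<in>I. indicator (A i) (\<omega> i) :: ennreal)"
        using fin by (auto simp: indicator_def PiE_def Pi_def prod_zero_iff)
      then show "(\<Prod>i\<in>I. w i (\<omega> i)) * indicator (Pi\<^sub>E I A) \<omega>
          = (\<Prod>i\<in>I. w i (\<omega> i) * indicator (A i) (\<omega> i))"
        by (simp add: prod.distrib)
    qed
    also have "\<dots> = (\<Prod>i\<in>I. \<integral>\<^sup>+x. w i x * indicator (A i) x \<partial>M i)"
      using fin by (intro M.product_nn_integral_prod) measurable
    also have "\<dots> = (\<Prod>i\<in>I. emeasure (density (M i) (w i)) (A i))"
      by (intro prod.cong refl) (simp add: emeasure_density)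
    finally show "emeasure (density (PiM I M) (\<lambda>\<omega>. \<Prod>i\<in>I. w i (\<omega> i))) (Pi\<^sub>E I A)
        = (\<Prod>i\<in>I. emeasure (density (M i) (w i)) (A i))" .
  qed
qed

text \<open>
  The transition operator of a random walk with step \<open>Y\<close>. Its powers give expectations of functions
  of i.i.d. sums, so that replacing summands one at a time becomes a telescoping identity between
  powers of two commuting contractions.
\<close>

definition shift_average :: "'a measure \<Rightarrow> ('a \<Rightarrow> real) \<Rightarrow> (real \<Rightarrow> real) \<Rightarrow> real \<Rightarrow> real" where
  "shift_average M Y g u = (\<integral>x. g (u + Y x) \<partial>M)"

lemma shift_average_measurable:
  assumes "prob_space M" and [measurable]: "Y \<in> borel_measurable M" "g \<in> borel_measurable borel"
  shows "shift_average M Y g \<in> borel_measurable borel"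
proof -
  interpret prob_space M by fact
  show ?thesis unfolding shift_average_def[abs_def] by measurable
qed

lemma integrable_shift:
  fixes g :: "real \<Rightarrow> real"
  assumes "prob_space M" and [measurable]: "Y \<in> borel_measurable M" "g \<in> borel_measurable borel"
    and "\<And>u. \<bar>g u\<bar> \<le> B"
  shows "integrable M (\<lambda>x. g (u + Y x))"
proof -
  interpret prob_space M by fact
  show ?thesis by (rule integrable_const_bound[where B=B]) (use assms(4) in auto)
qed

lemma shift_average_bound:
  assumes "prob_space M" and [measurable]: "Y \<in> borel_measurable M" "g \<in> borel_measurable borel"
    and b: "\<And>u. \<bar>g u\<bar> \<le> B"
  shows "\<bar>shift_average M Y g u\<bar> \<le> B"
proof -
  interpret prob_space M by fact
  note i = integrable_shift[OF assms]
  have "\<bar>shift_average M Y g u\<bar> \<le> (\<integral>x. \<bar>g (u + Y x)\<bar> \<partial>M)"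
    unfolding shift_average_def by (rule integral_abs_bound)
  also have "\<dots> \<le> (\<integral>x. B \<partial>M)"
    by (rule integral_mono) (use i b in auto)
  finally show ?thesis by (simp add: prob_space)
qed

lemma shift_average_diff:
  assumes "prob_space M" "Y \<in> borel_measurable M"
    and "g \<in> borel_measurable borel" "\<And>u. \<bar>g u\<bar> \<le> B"
    and "h \<in> borel_measurable borel" "\<And>u. \<bar>h u\<bar> \<le> C"
  shows "shift_average M Y (\<lambda>u. g u - h u) u = shift_average M Y g u - shift_average M Y h u"
  unfolding shift_average_def
  by (rule Bochner_Integration.integral_diff)
     (use integrable_shift[OF assms(1,2,3,4)] integrable_shift[OF assms(1,2,5,6)] in auto)

text \<open>
  Fubini; independent steps may be taken in either order.
\<close>

lemma shift_average_commute:
  assumes M: "prob_space M" and N: "prob_space N"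
    and [measurable]: "Y \<in> borel_measurable M" "Z \<in> borel_measurable N" "g \<in> borel_measurable borel"
    and b: "\<And>u. \<bar>g u\<bar> \<le> B"
  shows "shift_average M Y (shift_average N Z g) = shift_average N Z (shift_average M Y g)"
proof
  fix u
  interpret M: prob_space M by fact
  interpret N: prob_space N by fact
  interpret MN: pair_prob_space M N ..
  have "integrable (M \<Otimes>\<^sub>M N) (\<lambda>(x, y). g (u + Y x + Z y))"
    by (rule MN.P.integrable_const_bound[where B=B]) (use b in auto)
  from MN.Fubini_integral[OF this]
  have *: "(\<integral>y. \<integral>x. g (u + Y x + Z y) \<partial>M \<partial>N) = (\<integral>x. \<integral>y. g (u + Y x + Z y) \<partial>N \<partial>M)" .
  show "shift_average M Y (shift_average N Z g) u = shift_average N Z (shift_average M Y g) u"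
    using * unfolding shift_average_def by (simp add: ac_simps)
qed

lemma funpow_shift_average_bounded:
  assumes "prob_space M" "Y \<in> borel_measurable M" "g \<in> borel_measurable borel"
    and "\<And>u. \<bar>g u\<bar> \<le> B"
  shows "(shift_average M Y ^^ n) g \<in> borel_measurable borel \<and> (\<forall>u. \<bar>(shift_average M Y ^^ n) g u\<bar> \<le> B)"
  using assms(3,4)
proof (induction n)
  case (Suc n)
  then show ?case
    using shift_average_measurable[OF assms(1,2)] shift_average_bound[OF assms(1,2)] by simp
qed simp

lemma expectation_shifted_sum:
  assumes M: "prob_space M" and [measurable]: "Y \<in> borel_measurable M" "g \<in> borel_measurable borel"
    and b: "\<And>u. \<bar>g u\<bar> \<le> B" and fin: "finite I"
  shows "(\<integral>\<omega>. g (u + (\<Sum>i\<in>I. Y (\<omega> i))) \<partial>PiM I (\<lambda>_. M)) = (shift_average M Y ^^ card I) g u"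
  using fin assms(3,4)
proof (induction I arbitrary: g)
  case empty
  then show ?case by (simp add: PiM_empty lebesgue_integral_count_space_finite)
next
  case (insert i I)
  note [measurable] = insert.prems(1)
  interpret prob_space M by (rule M)
  interpret product_prob_space "\<lambda>_. M" by standard
  interpret I: prob_space "PiM I (\<lambda>_. M)" by (intro prob_space_PiM M)
  interpret iI: prob_space "PiM (insert i I) (\<lambda>_. M)" by (intro prob_space_PiM M)
  have int: "integrable (PiM (insert i I) (\<lambda>_. M)) (\<lambda>\<omega>. g (u + (\<Sum>j\<in>insert i I. Y (\<omega> j))))"
    by (rule iI.integrable_const_bound[where B=B]) (use insert.prems(2) in auto)
  have "(\<integral>\<omega>. g (u + (\<Sum>j\<in>insert i I. Y (\<omega> j))) \<partial>PiM (insert i I) (\<lambda>_. M))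
      = (\<integral>\<omega>. \<integral>y. g (u + (\<Sum>j\<in>insert i I. Y (fun_upd \<omega> i y j))) \<partial>M \<partial>PiM I (\<lambda>_. M))"
    by (rule product_integral_insert[OF insert.hyps(1,2) int])
  also have "\<dots> = (\<integral>\<omega>. shift_average M Y g (u + (\<Sum>j\<in>I. Y (\<omega> j))) \<partial>PiM I (\<lambda>_. M))"
  proof (intro Bochner_Integration.integral_cong refl)
    fix \<omega>
    have "(\<Sum>j\<in>insert i I. Y (fun_upd \<omega> i y j)) = (\<Sum>j\<in>I. Y (\<omega> j)) + Y y" for y
    proof -
      have "(\<Sum>j\<in>I. Y (fun_upd \<omega> i y j)) = (\<Sum>j\<in>I. Y (\<omega> j))"
        using insert.hyps by (intro sum.cong) auto
      then show ?thesis using insert.hyps by simp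
    qed
    then show "(\<integral>y. g (u + (\<Sum>j\<in>insert i I. Y (fun_upd \<omega> i y j))) \<partial>M)
        = shift_average M Y g (u + (\<Sum>j\<in>I. Y (\<omega> j)))"
      unfolding shift_average_def by (simp only: add.assoc)
  qed
  also have "\<dots> = (shift_average M Y ^^ card I) (shift_average M Y g) u"
    using insert.IH[OF shift_average_measurable[OF M assms(2) insert.prems(1)]
        shift_average_bound[OF M assms(2) insert.prems(1,2)]] .
  also have "\<dots> = (shift_average M Y ^^ card (insert i I)) g u"
    using insert.hyps by (simp add: funpow_swap1)
  finally show ?case .
qed

text \<open>
  Exchanging all \<open>n\<close> steps costs at most \<open>n\<close> times the cost of exchanging one: in
  \<open>A\<^sup>n - G\<^sup>n = A\<^bsup>n-1\<^esup>(A - G) + (A\<^bsup>n-1\<^esup> - G\<^bsup>n-1\<^esup>) G\<close> both operators are contractions for the supremum norm and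
  commute, so the one-step bound for \<open>g\<close> passes to \<open>G g\<close>.
\<close>

lemma Lindeberg_swapping:
  assumes M: "prob_space M" and N: "prob_space N"
    and Y: "Y \<in> borel_measurable M" and Z: "Z \<in> borel_measurable N"
    and g: "g \<in> borel_measurable borel" "\<And>u. \<bar>g u\<bar> \<le> B"
    and step: "\<And>u. \<bar>shift_average M Y g u - shift_average N Z g u\<bar> \<le> e"
  shows "\<bar>(shift_average M Y ^^ n) g u - (shift_average N Z ^^ n) g u\<bar> \<le> real n * e"
  using g step
proof (induction n arbitrary: g u)
  case 0
  then show ?case by simp
next
  case (Suc n)
  let ?A = "shift_average M Y" and ?G = "shift_average N Z"
  note Ag = shift_average_measurable[OF M Y Suc.prems(1)] shift_average_bound[OF M Y Suc.prems(1,2)]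
  note Gg = shift_average_measurable[OF N Z Suc.prems(1)] shift_average_bound[OF N Z Suc.prems(1,2)]
  have d: "(\<lambda>u. ?A g u - ?G g u) \<in> borel_measurable borel" using Ag(1) Gg(1) by measurable
  have "\<bar>?A (?G g) u - ?G (?G g) u\<bar> \<le> e" for u
  proof -
    have "?A (?G g) u - ?G (?G g) u = ?G (\<lambda>u. ?A g u - ?G g u) u"
      unfolding shift_average_diff[OF N Z Ag Gg]
        shift_average_commute[OF M N Y Z Suc.prems(1,2)] ..
    then show ?thesis using shift_average_bound[OF N Z d Suc.prems(3)] by simp
  qed
  note G_part = Suc.IH[OF Gg this, of u]
  have A_part: "(?A ^^ n) (?A g) u - (?A ^^ n) (?G g) u = (?A ^^ n) (\<lambda>u. ?A g u - ?G g u) u"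
    for u
  proof (induction n arbitrary: u)
    case (Suc n)
    have "?A (\<lambda>u. (?A ^^ n) (?A g) u - (?A ^^ n) (?G g) u) u
        = ?A ((?A ^^ n) (?A g)) u - ?A ((?A ^^ n) (?G g)) u"
      using funpow_shift_average_bounded[OF M Y Ag] funpow_shift_average_bounded[OF M Y Gg]
      by (intro shift_average_diff[OF M Y]) auto
    then show ?case by (simp add: Suc)
  qed simp
  have "\<bar>(?A ^^ n) (\<lambda>u. ?A g u - ?G g u) u\<bar> \<le> e"
    using funpow_shift_average_bounded[OF M Y d Suc.prems(3)] by blast
  with A_part[of u] G_part
  have "\<bar>(?A ^^ n) (?A g) u - (?G ^^ n) (?G g) u\<bar> \<le> e + real n * e" by linarith
  then show ?case by (simp add: funpow_swap1 algebra_simps)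
qed

section \<open>A smooth cutoff and second-order expansion of averages\<close>

text \<open>
  The integral of the quadratic B-spline on \<open>[0, 3]\<close>, written as a third difference of the truncated
  cube. It rises from 0 to 1 and has a Lipschitz second derivative, which is the
  smoothness that the third-order error bound in Lindeberg's argument relies on. The two
  definitions after it are its first and second derivative.
\<close>

definition smoothstep :: "real \<Rightarrow> real" where
  "smoothstep w = (max 0 w ^ 3 - 3 * max 0 (w - 1) ^ 3 + 3 * max 0 (w - 2) ^ 3 - max 0 (w - 3) ^ 3) / 6"

definition smoothstep1 :: "real \<Rightarrow> real" where
  "smoothstep1 w = (max 0 w ^ 2 - 3 * max 0 (w - 1) ^ 2 + 3 * max 0 (w - 2) ^ 2 - max 0 (w - 3) ^ 2) / 2"

definition smoothstep2 :: "real \<Rightarrow> real" where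
  "smoothstep2 w = max 0 w - 3 * max 0 (w - 1) + 3 * max 0 (w - 2) - max 0 (w - 3)"

lemma positive_part_power_has_derivative:
  "((\<lambda>w. max 0 w ^ Suc (Suc k)) has_real_derivative real (Suc (Suc k)) * max 0 w ^ Suc k) (at w)"
proof -
  consider "w < 0" | "w > 0" | "w = 0" by linarith
  then show ?thesis
  proof cases
    case 1
    have "((\<lambda>w. 0) has_real_derivative 0) (at w)" by simp
    then have "((\<lambda>w. max 0 w ^ Suc (Suc k)) has_real_derivative 0) (at w)"
      by (rule DERIV_cong_ev[THEN iffD1, rotated -1])
         (use 1 eventually_nhds_in_open[of "{..<0}" w] in \<open>auto elim!: eventually_mono\<close>)
    then show ?thesis using 1 by simp
  next
    case 2
    have "((\<lambda>w. w ^ Suc (Suc k)) has_real_derivative real (Suc (Suc k)) * w ^ Suc k) (at w)"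
      by (rule derivative_eq_intros refl | simp)+
    then have "((\<lambda>w. max 0 w ^ Suc (Suc k)) has_real_derivative real (Suc (Suc k)) * w ^ Suc k) (at w)"
      by (rule DERIV_cong_ev[THEN iffD1, rotated -1])
         (use 2 eventually_nhds_in_open[of "{0<..}" w] in \<open>auto elim!: eventually_mono\<close>)
    then show ?thesis using 2 by simp
  next
    case 3
    have "((\<lambda>h::real. max 0 h ^ Suc (Suc k) / h) \<longlongrightarrow> 0) (at 0)"
    proof (rule Lim_null_comparison)
      show "eventually (\<lambda>h. norm (max 0 h ^ Suc (Suc k) / h) \<le> \<bar>h\<bar> ^ Suc k) (at (0::real))"
        by (intro always_eventually allI) (auto simp: max_def mult_nonpos_nonneg)
      show "((\<lambda>h::real. \<bar>h\<bar> ^ Suc k) \<longlongrightarrow> 0) (at 0)"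
        by (auto intro!: tendsto_eq_intros)
    qed
    then show ?thesis using 3 by (simp add: DERIV_def)
  qed
qed

lemma smoothstep_deriv: "(smoothstep has_real_derivative smoothstep1 w) (at w)"
  "(smoothstep1 has_real_derivative smoothstep2 w) (at w)"
proof -
  have *: "((\<lambda>w. max 0 (w - c) ^ Suc (Suc k)) has_real_derivative
      real (Suc (Suc k)) * max 0 (w - c) ^ Suc k) (at w)" for c k
    using positive_part_power_has_derivative[of k "w + - c"] unfolding DERIV_shift by simp
  have d3: "((\<lambda>w. max 0 (w - c) ^ 3) has_real_derivative 3 * max 0 (w - c) ^ 2) (at w)" for c
    using *[of c 1] by (simp add: eval_nat_numeral)
  have d2: "((\<lambda>w. max 0 (w - c) ^ 2) has_real_derivative 2 * max 0 (w - c)) (at w)" for c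
    using *[of c 0] by (simp add: eval_nat_numeral)
  show "(smoothstep has_real_derivative smoothstep1 w) (at w)"
    using DERIV_cdivide[OF DERIV_diff[OF DERIV_add[OF DERIV_diff[OF d3[of 0] DERIV_cmult[OF d3[of 1], of 3]]
      DERIV_cmult[OF d3[of 2], of 3]] d3[of 3]], of 6]
    unfolding smoothstep_def[abs_def] smoothstep1_def
    by (simp add: diff_divide_distrib add_divide_distrib)
  show "(smoothstep1 has_real_derivative smoothstep2 w) (at w)"
    using DERIV_cdivide[OF DERIV_diff[OF DERIV_add[OF DERIV_diff[OF d2[of 0] DERIV_cmult[OF d2[of 1], of 3]]
      DERIV_cmult[OF d2[of 2], of 3]] d2[of 3]], of 2]
    unfolding smoothstep1_def[abs_def] smoothstep2_def
    by (simp add: diff_divide_distrib add_divide_distrib)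
qed

lemma smoothstep2_Lipschitz: "\<bar>smoothstep2 v - smoothstep2 w\<bar> \<le> 8 * \<bar>v - w\<bar>"
proof -
  define D where "D c = max 0 (v - c) - max 0 (w - c)" for c
  have D: "\<bar>D c\<bar> \<le> \<bar>v - w\<bar>" for c unfolding D_def by (auto simp: max_def)
  have "smoothstep2 v - smoothstep2 w = D 0 - 3 * D 1 + 3 * D 2 - D 3"
    unfolding smoothstep2_def D_def by (simp add: algebra_simps)
  moreover obtain d where "d = \<bar>v - w\<bar>" by simp
  ultimately show ?thesis
    using D[of 0] D[of 1] D[of 2] D[of 3] by (simp add: abs_le_iff)
qed

lemma smoothstep_eq_0: "w \<le> 0 \<Longrightarrow> smoothstep w = 0"
  unfolding smoothstep_def by (simp add: max_def)

lemma smoothstep_eq_1: "w \<ge> 3 \<Longrightarrow> smoothstep w = 1"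
  unfolding smoothstep_def by (simp add: max_def power3_eq_cube algebra_simps)

lemma smoothstep1_nonneg: "smoothstep1 w \<ge> 0"
proof -
  consider "w \<le> 1" | "1 \<le> w" "w \<le> 2" | "2 \<le> w" "w \<le> 3" | "w \<ge> 3" by linarith
  then show ?thesis
  proof cases
    case 1 then show ?thesis by (simp add: smoothstep1_def max_def)
  next
    case 2
    then have "(w - 1) * (2 - w) \<ge> 0" by simp
    with 2 show ?thesis by (simp add: smoothstep1_def max_def power2_eq_square algebra_simps)
  next
    case 3
    have "(3 - w)\<^sup>2 \<ge> 0" by simp
    with 3 show ?thesis by (simp add: smoothstep1_def max_def power2_eq_square algebra_simps)
  next
    case 4 then show ?thesis by (simp add: smoothstep1_def max_def power2_eq_square algebra_simps)
  qed
qed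

lemma smoothstep_mono: "v \<le> w \<Longrightarrow> smoothstep v \<le> smoothstep w"
  by (rule DERIV_nonneg_imp_nondecreasing) (use smoothstep_deriv(1) smoothstep1_nonneg in blast)+

lemma smoothstep_range: "0 \<le> smoothstep w" "smoothstep w \<le> 1"
  using smoothstep_mono[of "min w 0" w] smoothstep_mono[of w "max w 3"]
  by (auto simp: smoothstep_eq_0 smoothstep_eq_1)

text \<open>
  A Lipschitz second derivative replaces a bounded third one, which the spline cutoff does not have
  at its knots.
\<close>

lemma Taylor2_Lipschitz:
  fixes g g1 g2 :: "real \<Rightarrow> real"
  assumes d1: "\<And>x. (g has_real_derivative g1 x) (at x)" and d2: "\<And>x. (g1 has_real_derivative g2 x) (at x)"
    and L: "\<And>x y. \<bar>g2 x - g2 y\<bar> \<le> L * \<bar>x - y\<bar>"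
  shows "\<bar>g (u + y) - (g u + g1 u * y + g2 u * y\<^sup>2 / 2)\<bar> \<le> L / 2 * \<bar>y\<bar> ^ 3"
proof -
  define d where "d m = (case m of 0 \<Rightarrow> (\<lambda>t. g (u + t)) | Suc 0 \<Rightarrow> (\<lambda>t. g1 (u + t)) | _ \<Rightarrow> (\<lambda>t. g2 (u + t)))"
    for m :: nat
  have "\<exists>t. \<bar>t\<bar> \<le> \<bar>y\<bar> \<and> g (u + y) = (\<Sum>m<2. d m 0 / fact m * y ^ m) + d 2 t / fact 2 * y ^ 2"
  proof (rule Maclaurin_bi_le)
    show "d 0 = (\<lambda>t. g (u + t))" by (simp add: d_def)
    show "\<forall>m t. m < 2 \<and> \<bar>t\<bar> \<le> \<bar>y\<bar> \<longrightarrow> (d m has_real_derivative d (Suc m) t) (at t)"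
    proof (intro allI impI)
      fix m :: nat and t assume "m < 2 \<and> \<bar>t\<bar> \<le> \<bar>y\<bar>"
      then have "m = 0 \<or> m = Suc 0" by auto
      then show "(d m has_real_derivative d (Suc m) t) (at t)"
        using d1[of "t + u"] d2[of "t + u"] unfolding DERIV_shift
        by (auto simp: d_def add.commute)
    qed
  qed
  then obtain t where t: "\<bar>t\<bar> \<le> \<bar>y\<bar>"
    and eq: "g (u + y) = g u + g1 u * y + g2 (u + t) / 2 * y\<^sup>2"
    by (auto simp: d_def numeral_2_eq_2)
  have "g (u + y) - (g u + g1 u * y + g2 u * y\<^sup>2 / 2) = (g2 (u + t) - g2 u) / 2 * y\<^sup>2"
    unfolding eq by (simp add: algebra_simps diff_divide_distrib)
  also have "\<bar>\<dots>\<bar> = \<bar>g2 (u + t) - g2 u\<bar> / 2 * y\<^sup>2" by (simp add: abs_mult)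
  also have "\<dots> \<le> (L * \<bar>y\<bar>) / 2 * y\<^sup>2"
  proof -
    have "L \<ge> 0" using L[of 1 0] by simp
    then have "\<bar>g2 (u + t) - g2 u\<bar> \<le> L * \<bar>y\<bar>"
      using L[of "u + t" u] mult_left_mono[OF t, of L] by simp
    then show ?thesis by (intro mult_right_mono divide_right_mono) auto
  qed
  also have "\<dots> = L / 2 * \<bar>y\<bar> ^ 3"
    by (simp add: power3_eq_cube power2_eq_square)
  finally show ?thesis .
qed

lemma integrable_lower_powers:
  assumes "prob_space M" and [measurable]: "Y \<in> borel_measurable M"
    and i: "integrable M (\<lambda>x. \<bar>Y x\<bar> ^ 3 :: real)"
  shows "integrable M Y" "integrable M (\<lambda>x. (Y x)\<^sup>2)"
proof -
  interpret prob_space M by fact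
  have b: "integrable M (\<lambda>x. 1 + \<bar>Y x\<bar> ^ 3)" using i by simp
  have le: "\<bar>y\<bar> ^ k \<le> 1 + \<bar>y\<bar> ^ 3" if "k \<le> 3" for y :: real and k
  proof (cases "\<bar>y\<bar> \<le> 1")
    case True
    then have "\<bar>y\<bar> ^ k \<le> 1" by (simp add: power_le_one)
    then show ?thesis by (simp add: add_increasing2)
  next
    case False
    then have "\<bar>y\<bar> ^ k \<le> \<bar>y\<bar> ^ 3" using that by (intro power_increasing) auto
    then show ?thesis by simp
  qed
  show "integrable M Y"
    by (rule Bochner_Integration.integrable_bound[OF b]) (use le[of 1] in auto)
  show "integrable M (\<lambda>x. (Y x)\<^sup>2)"
    by (rule Bochner_Integration.integrable_bound[OF b]) (use le[of 2] in auto)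
qed

text \<open>
  A single step enters only through its first two moments, up to an error of third order. Two step
  laws with equal mean and variance therefore have nearly the same average.
\<close>

lemma shift_average_Taylor:
  assumes M: "prob_space M" and [measurable]: "Y \<in> borel_measurable M" "g \<in> borel_measurable borel"
    and b: "\<And>u. \<bar>g u\<bar> \<le> B"
    and i: "integrable M (\<lambda>x. \<bar>Y x\<bar> ^ 3)"
    and d: "\<And>x. (g has_real_derivative g1 x) (at x)" "\<And>x. (g1 has_real_derivative g2 x) (at x)"
    and L: "\<And>x y. \<bar>g2 x - g2 y\<bar> \<le> L * \<bar>x - y\<bar>"
  shows "\<bar>shift_average M Y g u - (g u + g1 u * (\<integral>x. Y x \<partial>M) + g2 u * (\<integral>x. (Y x)\<^sup>2 \<partial>M) / 2)\<bar>
    \<le> L / 2 * (\<integral>x. \<bar>Y x\<bar> ^ 3 \<partial>M)"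
proof -
  interpret prob_space M by (rule M)
  note iY = integrable_lower_powers[OF M assms(2) i]
  have ig: "integrable M (\<lambda>x. g (u + Y x))" by (rule integrable_shift[OF M assms(2,3) b])
  have iq: "integrable M (\<lambda>x. g u + g1 u * Y x + g2 u * (Y x)\<^sup>2 / 2)" using iY by simp
  let ?R = "\<lambda>x. g (u + Y x) - (g u + g1 u * Y x + g2 u * (Y x)\<^sup>2 / 2)"
  have eq: "shift_average M Y g u - (g u + g1 u * (\<integral>x. Y x \<partial>M) + g2 u * (\<integral>x. (Y x)\<^sup>2 \<partial>M) / 2)
      = integral\<^sup>L M ?R"
    unfolding shift_average_def Bochner_Integration.integral_diff[OF ig iq]
    using iY by (simp add: prob_space)
  have pointwise: "\<bar>?R x\<bar> \<le> L / 2 * \<bar>Y x\<bar> ^ 3" for x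
    by (rule Taylor2_Lipschitz[of g g1 g2 L u "Y x"]) (fact d L)+
  have iR: "integrable M (\<lambda>x. \<bar>?R x\<bar>)"
    by (rule integrable_abs[OF Bochner_Integration.integrable_diff[OF ig iq]])
  have "\<bar>integral\<^sup>L M ?R\<bar> \<le> (\<integral>x. \<bar>?R x\<bar> \<partial>M)"
    by (rule integral_abs_bound)
  also have "\<dots> \<le> (\<integral>x. L / 2 * \<bar>Y x\<bar> ^ 3 \<partial>M)"
    by (rule integral_mono[OF iR integrable_mult_right[OF i] pointwise])
  also have "\<dots> = L / 2 * (\<integral>x. \<bar>Y x\<bar> ^ 3 \<partial>M)"
    by (rule integral_mult_right_zero)
  finally show ?thesis unfolding eq .
qed

lemma std_normal_moments:
  "prob_space std_normal_distribution" "integrable std_normal_distribution (\<lambda>x. \<bar>x\<bar> ^ 3)"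
  "(\<integral>x. x \<partial>std_normal_distribution) = 0"
  "(\<integral>x. x\<^sup>2 \<partial>std_normal_distribution) = 1"
  "(\<integral>x. \<bar>x\<bar> ^ 3 \<partial>std_normal_distribution) \<le> 2"
proof -
  show "prob_space std_normal_distribution" by (simp add: prob_space_normal_density)
  show "integrable std_normal_distribution (\<lambda>x. \<bar>x\<bar> ^ 3)"
    using integrable_std_normal_moment_abs[of 3] by (subst integrable_real_density) auto
  show "(\<integral>x. x \<partial>std_normal_distribution) = 0"
    using integral_std_normal_moment_odd[of 0] by (subst integral_real_density) auto
  show "(\<integral>x. x\<^sup>2 \<partial>std_normal_distribution) = 1"
    using integral_std_normal_moment_even[of 1] by (subst integral_real_density) (auto simp: fact_numeral)
  have "(\<integral>x. \<bar>x\<bar> ^ 3 \<partial>std_normal_distribution) = sqrt (2 / pi) * 2"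
    using integral_std_normal_moment_abs_odd[of 1]
    by (subst integral_real_density) (auto simp: numeral_3_eq_3)
  also have "\<dots> \<le> 1 * 2"
    using pi_gt3 by (intro mult_right_mono) auto
  finally show "(\<integral>x. \<bar>x\<bar> ^ 3 \<partial>std_normal_distribution) \<le> 2" by simp
qed

text \<open>
  Stability of the normal law is what makes the comparison walk explicit: after \<open>n\<close> normal steps its
  rescaled position is exactly standard normal.
\<close>

lemma std_normal_iid_sum:
  assumes n: "n \<ge> 1"
  shows "distr (PiM {1..n} (\<lambda>_. std_normal_distribution)) borel (\<lambda>\<omega>. (\<Sum>i=1..n. \<omega> i) / sqrt (real n)) = std_normal_distribution"
proof -
  let ?P = "PiM {1..n} (\<lambda>_. std_normal_distribution)"
  interpret P: prob_space ?P by (intro prob_space_PiM std_normal_moments)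
  interpret N: prob_space std_normal_distribution by (rule std_normal_moments)
  interpret pp: product_prob_space "\<lambda>_. std_normal_distribution" "{1..n}" by standard
  have comp: "distr ?P borel (\<lambda>\<omega>. \<omega> i) = std_normal_distribution" if "i \<in> {1..n}" for i
    using pp.PiM_component[OF that] by (simp cong: distr_cong)
  have "P.indep_vars (\<lambda>_. borel) (\<lambda>i \<omega>. \<omega> i) {1..n}"
  proof (subst P.indep_vars_iff_distr_eq_PiM')
    show "{1..n} \<noteq> {}" using n by auto
    show "(\<lambda>\<omega>. \<omega> i) \<in> borel_measurable ?P" if "i \<in> {1..n}" for i
      using measurable_component_singleton[OF that, of "\<lambda>_. std_normal_distribution"] by simp
    have "distr ?P (PiM {1..n} (\<lambda>_. borel)) (\<lambda>x. \<lambda>i\<in>{1..n}. x i) = distr ?P ?P (\<lambda>x. x)"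
      by (intro distr_cong sets_PiM_cong refl) (auto simp: space_PiM PiE_def intro!: extensional_restrict)
    also have "\<dots> = ?P" by simp
    also have "\<dots> = PiM {1..n} (\<lambda>i. distr ?P borel (\<lambda>\<omega>. \<omega> i))"
      by (intro PiM_cong refl comp[symmetric])
    finally show "distr ?P (PiM {1..n} (\<lambda>_. borel)) (\<lambda>x. \<lambda>i\<in>{1..n}. x i)
        = PiM {1..n} (\<lambda>i. distr ?P borel (\<lambda>\<omega>. \<omega> i))" .
  qed
  moreover have "distributed ?P lborel (\<lambda>\<omega>. \<omega> i) (normal_density 0 1)" if "i \<in> {1..n}" for i
    using comp[OF that] measurable_component_singleton[OF that, of "\<lambda>_. std_normal_distribution"]
    unfolding distributed_def by (simp cong: distr_cong)
  ultimately have "distributed ?P lborel (\<lambda>\<omega>. \<Sum>i=1..n. \<omega> i)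
      (normal_density (\<Sum>i=1..n. 0) (sqrt (\<Sum>i=1..n. 1\<^sup>2)))"
    using n by (intro P.sum_indep_normal) auto
  then have "distributed ?P lborel (\<lambda>\<omega>. \<Sum>i=1..n. \<omega> i) (normal_density 0 (sqrt (real n)))"
    by simp
  then have "distributed ?P lborel (\<lambda>\<omega>. ((\<Sum>i=1..n. \<omega> i) - 0) / sqrt (real n)) std_normal_density"
    using n by (subst (asm) P.normal_standard_normal_convert) auto
  then show ?thesis unfolding distributed_def by (simp cong: distr_cong)
qed

section \<open>A central limit theorem with polynomial rate\<close>

text \<open>
  The cutoff \<open>g\<close> has width \<open>\<delta>\<close> after rescaling, hence width \<open>\<delta> \<surd>n\<close> on the scale of the sum, and its second
  derivative there has Lipschitz constant \<open>8 / (\<delta> \<surd>n)\<^sup>3\<close>. Swapping \<open>n\<close> steps for normal ones then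
  costs \<open>n\<close> times half of that constant times the two third absolute moments; the normal one is at
  most 2.
\<close>

lemma smoothed_CLT:
  fixes u :: real and n :: nat
  assumes M: "prob_space M" and Y[measurable]: "Y \<in> borel_measurable M"
    and i: "integrable M (\<lambda>x. \<bar>Y x\<bar> ^ 3)"
    and mean: "(\<integral>x. Y x \<partial>M) = 0" and var: "(\<integral>x. (Y x)\<^sup>2 \<partial>M) = 1"
    and n: "n \<ge> 1" and \<delta>: "\<delta> > 0"
  defines "g \<equiv> \<lambda>w. 1 - smoothstep ((w - u) / \<delta>)"
  shows "\<bar>(\<integral>\<omega>. g ((\<Sum>i=1..n. Y (\<omega> i)) / sqrt n) \<partial>PiM {1..n} (\<lambda>_. M)) - (\<integral>x. g x \<partial>std_normal_distribution)\<bar>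
    \<le> 4 / (\<delta> ^ 3 * sqrt n) * ((\<integral>x. \<bar>Y x\<bar> ^ 3 \<partial>M) + 2)"
proof -
  let ?N = std_normal_distribution
  define s where "s = sqrt (real n)"
  have s: "s > 0" "s\<^sup>2 = real n" using n by (auto simp: s_def)
  \<comment> \<open>The test function on the scale of the unnormalized sum, with its two derivatives.\<close>
  define h where "h w = g (w / s)" for w
  define h1 where "h1 w = - (smoothstep1 ((w / s - u) / \<delta>) / (\<delta> * s))" for w
  define h2 where "h2 w = - (smoothstep2 ((w / s - u) / \<delta>) / (\<delta> * s)\<^sup>2)" for w
  define L where "L = 8 / (\<delta> * s) ^ 3"
  have inner: "((\<lambda>w. (w / s - u) / \<delta>) has_real_derivative 1 / (\<delta> * s)) (at w)" for w
    using s \<delta> by (auto intro!: derivative_eq_intros simp: field_simps)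
  have dh: "(h has_real_derivative h1 w) (at w)" for w
    using DERIV_diff[OF DERIV_const[of 1] DERIV_chain2[OF smoothstep_deriv(1) inner[of w]]]
    unfolding h_def[abs_def] g_def h1_def by simp
  have dh1: "(h1 has_real_derivative h2 w) (at w)" for w
    using DERIV_minus[OF DERIV_cdivide[OF DERIV_chain2[OF smoothstep_deriv(2) inner[of w]], of "\<delta> * s"]]
    unfolding h1_def[abs_def] h2_def by (simp add: power2_eq_square)
  have lip: "\<bar>h2 x - h2 y\<bar> \<le> L * \<bar>x - y\<bar>" for x y
  proof -
    let ?f = "\<lambda>w. (w / s - u) / \<delta>"
    have "h2 x - h2 y = - ((smoothstep2 (?f x) - smoothstep2 (?f y)) / (\<delta> * s)\<^sup>2)"
      unfolding h2_def by (simp add: diff_divide_distrib)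
    then have "\<bar>h2 x - h2 y\<bar> = \<bar>smoothstep2 (?f x) - smoothstep2 (?f y)\<bar> / (\<delta> * s)\<^sup>2"
      by simp
    also have "\<dots> \<le> (8 * \<bar>?f x - ?f y\<bar>) / (\<delta> * s)\<^sup>2"
      by (intro divide_right_mono smoothstep2_Lipschitz) simp
    also have "?f x - ?f y = (x - y) / (\<delta> * s)"
      using s \<delta> by (simp add: field_simps)
    also have "(8 * \<bar>(x - y) / (\<delta> * s)\<bar>) / (\<delta> * s)\<^sup>2 = L * \<bar>x - y\<bar>"
      using s \<delta> by (simp add: L_def abs_divide abs_mult power2_eq_square power3_eq_cube)
    finally show ?thesis .
  qed
  have cont: "continuous_on UNIV h"
    using dh by (intro DERIV_continuous_on) auto
  have hm: "h \<in> borel_measurable borel"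
    using cont by (rule borel_measurable_continuous_onI)
  have gm[measurable]: "g \<in> borel_measurable borel"
  proof -
    have "g = (\<lambda>w. h (w * s))" using s by (simp add: h_def fun_eq_iff)
    then show ?thesis using hm by simp
  qed
  have hb: "\<bar>h w\<bar> \<le> 1" for w
    unfolding h_def g_def using smoothstep_range[of "(w / s - u) / \<delta>"] by auto
  note N = std_normal_moments
  have id: "(\<lambda>x. x) \<in> borel_measurable ?N" by simp
  let ?e = "4 / (\<delta> * s) ^ 3 * ((\<integral>x. \<bar>Y x\<bar> ^ 3 \<partial>M) + 2)"
  have L0: "L \<ge> 0" unfolding L_def using s \<delta> by simp
  have step: "\<bar>shift_average M Y h w - shift_average ?N (\<lambda>x. x) h w\<bar> \<le> ?e" for w
  proof -
    have "\<bar>shift_average M Y h w - (h w + h2 w / 2)\<bar> \<le> L / 2 * (\<integral>x. \<bar>Y x\<bar> ^ 3 \<partial>M)"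
      using shift_average_Taylor[OF M Y hm hb i dh dh1 lip, of w] by (simp add: mean var)
    moreover have "\<bar>shift_average ?N (\<lambda>x. x) h w - (h w + h2 w / 2)\<bar> \<le> L / 2 * (\<integral>x. \<bar>x\<bar> ^ 3 \<partial>?N)"
      using shift_average_Taylor[OF N(1) id hm hb N(2) dh dh1 lip, of w] by (simp add: N)
    moreover have "L / 2 * (\<integral>x. \<bar>x\<bar> ^ 3 \<partial>?N) \<le> L / 2 * 2"
      using N(5) L0 by (intro mult_left_mono) auto
    ultimately have "\<bar>shift_average M Y h w - shift_average ?N (\<lambda>x. x) h w\<bar>
        \<le> L / 2 * (\<integral>x. \<bar>Y x\<bar> ^ 3 \<partial>M) + L / 2 * 2" by linarith
    also have "\<dots> = ?e" by (simp add: L_def algebra_simps add_divide_distrib)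
    finally show ?thesis .
  qed
  have "\<bar>(shift_average M Y ^^ n) h 0 - (shift_average ?N (\<lambda>x. x) ^^ n) h 0\<bar> \<le> real n * ?e"
    by (rule Lindeberg_swapping[OF M N(1) Y id hm hb step])
  moreover have "(shift_average M Y ^^ n) h 0
      = (\<integral>\<omega>. g ((\<Sum>i=1..n. Y (\<omega> i)) / sqrt n) \<partial>PiM {1..n} (\<lambda>_. M))"
    using expectation_shifted_sum[OF M Y hm hb finite_atLeastAtMost[of 1 n], of 0]
    by (simp add: h_def[abs_def] s_def)
  moreover have "(shift_average ?N (\<lambda>x. x) ^^ n) h 0 = (\<integral>x. g x \<partial>?N)"
  proof -
    have "(shift_average ?N (\<lambda>x. x) ^^ n) h 0
        = (\<integral>\<omega>. g ((\<Sum>i=1..n. \<omega> i) / sqrt n) \<partial>PiM {1..n} (\<lambda>_. ?N))"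
      using expectation_shifted_sum[OF N(1) id hm hb finite_atLeastAtMost[of 1 n], of 0]
      by (simp add: h_def[abs_def] s_def)
    also have "\<dots> = (\<integral>x. g x \<partial>distr (PiM {1..n} (\<lambda>_. ?N)) borel (\<lambda>\<omega>. (\<Sum>i=1..n. \<omega> i) / sqrt (real n)))"
      by (subst integral_distr) auto
    also have "\<dots> = (\<integral>x. g x \<partial>?N)" unfolding std_normal_iid_sum[OF n] ..
    finally show ?thesis .
  qed
  moreover have "real n * ?e = 4 / (\<delta> ^ 3 * sqrt n) * ((\<integral>x. \<bar>Y x\<bar> ^ 3 \<partial>M) + 2)"
    using s \<delta> unfolding s(2)[symmetric] s_def[symmetric]
    by (simp add: power_mult_distrib power2_eq_square power3_eq_cube field_simps)
  ultimately show ?thesis by simp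
qed

text \<open>
  The normal density is at most \<open>1 / \<surd>(2 \<pi>) \<le> 1 / 2\<close>.
\<close>

lemma std_normal_interval_le:
  assumes "a \<le> b"
  shows "measure std_normal_distribution {a<..b} \<le> (b - a) / 2"
proof -
  interpret prob_space std_normal_distribution by (rule std_normal_moments)
  have "emeasure std_normal_distribution {a<..b} = (\<integral>\<^sup>+x. ennreal (std_normal_density x) * indicator {a<..b} x \<partial>lborel)"
    by (subst emeasure_density) auto
  also have "\<dots> \<le> (\<integral>\<^sup>+x. ennreal (1/2) * indicator {a<..b} x \<partial>lborel)"
  proof (intro nn_integral_mono mult_right_mono ennreal_leI)
    fix x :: real
    have "2\<^sup>2 \<le> 2 * pi" using pi_gt3 by simp
    then have "2 \<le> sqrt (2 * pi)" by (rule real_le_rsqrt)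
    then have "1 / sqrt (2 * pi) * exp (- x\<^sup>2 / 2) \<le> 1 / 2 * 1"
      by (intro mult_mono divide_left_mono) (auto simp: field_simps)
    then show "std_normal_density x \<le> 1 / 2" by (simp add: std_normal_density_def)
  qed simp
  also have "\<dots> = ennreal (1/2) * ennreal (b - a)"
    using assms by (subst nn_integral_cmult_indicator) auto
  also have "\<dots> = ennreal ((b - a) / 2)"
    using assms by (subst ennreal_mult[symmetric]) auto
  finally show ?thesis using assms by (simp add: emeasure_eq_measure)
qed

text \<open>
  Indicators of half-lines are squeezed between cutoffs of width \<open>\<delta>\<close>. Smoothing costs \<open>O(\<delta>)\<close> because the
  normal distribution function is Lipschitz, and the smoothed comparison costs \<open>O(\<delta>\<^bsup>-3\<^esup> n\<^bsup>-1/2\<^esup>)\<close>; the choice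
  \<open>\<delta> = n\<^bsup>-1/8\<^esup>\<close> balances the two.
\<close>

theorem polynomial_Berry_Esseen:
  assumes M: "prob_space M" and Y[measurable]: "Y \<in> borel_measurable M"
    and i: "integrable M (\<lambda>x. \<bar>Y x\<bar> ^ 3)"
    and mean: "(\<integral>x. Y x \<partial>M) = 0" and var: "(\<integral>x. (Y x)\<^sup>2 \<partial>M) = 1"
    and n: "n \<ge> 1"
  shows "\<bar>measure (distr (PiM {1..n} (\<lambda>_. M)) borel (\<lambda>\<omega>. (\<Sum>i=1..n. Y (\<omega> i)) / sqrt n)) {..u}
      - measure std_normal_distribution {..u}\<bar>
    \<le> (4 * (\<integral>x. \<bar>Y x\<bar> ^ 3 \<partial>M) + 10) * real n powr (- (1/8))"
proof -
  let ?N = std_normal_distribution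
  let ?P = "PiM {1..n} (\<lambda>_. M)"
  let ?W = "\<lambda>\<omega>. (\<Sum>i=1..n. Y (\<omega> i)) / sqrt n"
  let ?D = "distr ?P borel ?W"
  interpret P: prob_space ?P by (intro prob_space_PiM M)
  interpret N: prob_space ?N by (rule std_normal_moments)
  have Wm: "?W \<in> borel_measurable ?P" by measurable
  interpret D: prob_space ?D by (rule P.prob_space_distr[OF Wm])
  define \<delta> where "\<delta> = real n powr (- (1/8))"
  have \<delta>: "\<delta> > 0" using n by (simp add: \<delta>_def)
  define e where "e = 4 / (\<delta> ^ 3 * sqrt n) * ((\<integral>x. \<bar>Y x\<bar> ^ 3 \<partial>M) + 2)"
  have "\<delta> ^ 3 * sqrt n * \<delta> = \<delta> ^ 4 * sqrt n" by (simp add: power4_eq_xxxx power3_eq_cube)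
  also have "\<delta> ^ 4 = real n powr (- (1/2))"
    unfolding \<delta>_def using n by (simp add: powr_power)
  also have "\<dots> * sqrt n = 1"
    using n by (simp add: powr_half_sqrt[symmetric] powr_add[symmetric])
  finally have "4 / (\<delta> ^ 3 * sqrt n) = 4 * \<delta>"
    using \<delta> n by (simp add: field_simps)
  then have e: "e = 4 * \<delta> * ((\<integral>x. \<bar>Y x\<bar> ^ 3 \<partial>M) + 2)" by (simp add: e_def)
  define g where "g u w = 1 - smoothstep ((w - u) / \<delta>)" for u w
  have gm[measurable]: "g u \<in> borel_measurable borel" for u
  proof -
    have "continuous_on UNIV smoothstep"
      using smoothstep_deriv(1) by (intro DERIV_continuous_on) auto
    then have [measurable]: "smoothstep \<in> borel_measurable borel" by (rule borel_measurable_continuous_onI)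
    show ?thesis unfolding g_def[abs_def] by measurable
  qed
  have gb: "0 \<le> g u w" "g u w \<le> 1" for u w
    unfolding g_def using smoothstep_range[of "(w - u) / \<delta>"] by auto
  have ind: "indicator {..u} w \<le> g u w" "g u w \<le> indicator {..u + 3 * \<delta>} w" for u w
  proof -
    show "indicator {..u} w \<le> g u w"
      using smoothstep_eq_0[of "(w - u) / \<delta>"] gb[of u w] \<delta>
      by (auto simp: g_def indicator_def divide_le_0_iff)
    show "g u w \<le> indicator {..u + 3 * \<delta>} w"
      using smoothstep_eq_1[of "(w - u) / \<delta>"] gb[of u w] \<delta>
      by (auto simp: g_def indicator_def le_divide_eq)
  qed
  have sandwich: "measure Q {..u} \<le> (\<integral>w. g u w \<partial>Q)" "(\<integral>w. g u w \<partial>Q) \<le> measure Q {..u + 3 * \<delta>}"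
    if Q: "prob_space Q" "sets Q = sets borel" for Q u
  proof -
    interpret Q: prob_space Q by (rule Q)
    note [measurable_cong] = Q(2)
    have ig: "integrable Q (g u)"
      by (rule Q.integrable_const_bound[where B = 1]) (use gb in auto)
    have ii: "integrable Q (indicator {..v} :: real \<Rightarrow> real)" for v
      by (rule Q.integrable_const_bound[where B = 1]) (auto simp: indicator_def)
    have m: "(\<integral>w. indicator {..v} w \<partial>Q) = measure Q {..v}" for v :: real
      using Q(2) by (simp add: sets_eq_imp_space_eq)
    show "measure Q {..u} \<le> (\<integral>w. g u w \<partial>Q)"
      unfolding m[symmetric] by (rule integral_mono[OF ii ig ind(1)])
    show "(\<integral>w. g u w \<partial>Q) \<le> measure Q {..u + 3 * \<delta>}"
      unfolding m[symmetric] by (rule integral_mono[OF ig ii ind(2)])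
  qed
  have close: "\<bar>(\<integral>w. g u w \<partial>?D) - (\<integral>w. g u w \<partial>?N)\<bar> \<le> e" for u
    using smoothed_CLT[OF M Y i mean var n \<delta>, of u] unfolding e_def g_def[symmetric]
    by (subst integral_distr) auto
  note sD = sandwich[OF D.prob_space_axioms sets_distr]
    and sN = sandwich[OF N.prob_space_axioms, simplified]
  have inc: "measure ?N {..v + 3 * \<delta>} \<le> measure ?N {..v} + 3 * \<delta> / 2" for v
  proof -
    have "{..v + 3 * \<delta>} = {..v} \<union> {v<..v + 3 * \<delta>}" using \<delta> by auto
    then have "measure ?N {..v + 3 * \<delta>} = measure ?N {..v} + measure ?N {v<..v + 3 * \<delta>}"
      using N.finite_measure_Union[of "{..v}" "{v<..v + 3 * \<delta>}"]
      by (metis ivl_disj_int_one(3) sets_density sets_lborel atMost_borel greaterThanAtMost_borel)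
    then show ?thesis using std_normal_interval_le[of v "v + 3 * \<delta>"] \<delta> by simp
  qed
  have "measure ?D {..u} \<le> measure ?N {..u} + 3 * \<delta> / 2 + e"
    using sD(1)[of u] close[of u] sN(2)[of u] inc[of u] by linarith
  moreover have "measure ?N {..u} - 3 * \<delta> / 2 - e \<le> measure ?D {..u}"
    using sD(2)[of "u - 3 * \<delta>"] close[of "u - 3 * \<delta>"] sN(1)[of "u - 3 * \<delta>"] inc[of "u - 3 * \<delta>"]
    by simp
  ultimately have "\<bar>measure ?D {..u} - measure ?N {..u}\<bar> \<le> e + 3 * \<delta> / 2" by linarith
  also have "\<dots> \<le> (4 * (\<integral>x. \<bar>Y x\<bar> ^ 3 \<partial>M) + 10) * \<delta>"
    unfolding e using \<delta> by (simp add: algebra_simps)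
  finally show ?thesis unfolding \<delta>_def .
qed

section \<open>Exponentially weighted upper half-lines\<close>

lemma nn_integral_exponential_Ici:
  fixes y w :: real
  assumes y: "y > 0"
  shows "(\<integral>\<^sup>+u. ennreal (y * exp (- y * u)) * indicator {w..} u \<partial>lborel) = ennreal (exp (- y * w))"
proof -
  have "(\<integral>\<^sup>+u. ennreal (y * exp (- y * u)) * indicator {w..} u \<partial>lborel)
      = ennreal (0 - (- exp (- y * w)))"
  proof (rule nn_integral_FTC_atLeast)
    show "((\<lambda>u. - exp (- y * u)) has_real_derivative y * exp (- y * u)) (at u)" for u
      by (auto intro!: derivative_eq_intros)
    have "filterlim (\<lambda>u. - y * u) at_bot at_top"
      using y by (intro filterlim_tendsto_neg_mult_at_bot[OF tendsto_const] filterlim_ident) auto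
    then have "((\<lambda>u. exp (- y * u)) \<longlongrightarrow> 0) at_top"
      by (rule filterlim_compose[OF exp_at_bot])
    then show "((\<lambda>u. - exp (- y * u)) \<longlongrightarrow> 0) at_top"
      using tendsto_minus by fastforce
  qed (use y in auto)
  then show ?thesis by simp
qed

text \<open>
  The integrand that remains of the indicator of the upper tail after the change of measure.
\<close>

definition exp_tail :: "real \<Rightarrow> real \<Rightarrow> real" where
  "exp_tail y w = exp (- y * w) * indicator {0<..} w"

lemma exp_tail_measurable[measurable]: "exp_tail y \<in> borel_measurable borel"
  unfolding exp_tail_def[abs_def] by measurable

lemma exp_tail_bounds: "y > 0 \<Longrightarrow> 0 \<le> exp_tail y w" "y > 0 \<Longrightarrow> exp_tail y w \<le> 1"
  unfolding exp_tail_def by (auto simp: indicator_def)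

lemma exp_tail_integral:
  assumes Q: "prob_space Q" "sets Q = sets borel" and y: "y > 0"
  shows "integrable Q (exp_tail y)"
    and "(\<integral>\<^sup>+w. ennreal (exp_tail y w) \<partial>Q) = ennreal (\<integral>w. exp_tail y w \<partial>Q)"
    and "0 \<le> (\<integral>w. exp_tail y w \<partial>Q)"
proof -
  interpret prob_space Q by (rule Q)
  note [measurable_cong] = Q(2)
  show i: "integrable Q (exp_tail y)"
    by (rule integrable_const_bound[where B = 1]) (use exp_tail_bounds[OF y] in auto)
  show "(\<integral>\<^sup>+w. ennreal (exp_tail y w) \<partial>Q) = ennreal (\<integral>w. exp_tail y w \<partial>Q)"
    by (rule nn_integral_eq_integral[OF i]) (use exp_tail_bounds[OF y] in auto)
  show "0 \<le> (\<integral>w. exp_tail y w \<partial>Q)"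
    by (rule integral_nonneg_AE) (use exp_tail_bounds[OF y] in auto)
qed

text \<open>
  Writes \<open>exp (- y w)\<close> for \<open>w > 0\<close> as the probability that an exponential variable of rate \<open>y\<close> exceeds
  \<open>w\<close>. The integral then depends on \<open>Q\<close> only through its distribution function, averaged with total
  weight one.
\<close>

lemma exp_tail_layer_cake:
  assumes Q: "prob_space Q" "sets Q = sets borel" and y: "y > 0"
  shows "ennreal (\<integral>w. exp_tail y w \<partial>Q)
    = (\<integral>\<^sup>+u. ennreal (y * exp (- y * u)) * ennreal (measure Q {0<..u}) \<partial>lborel)"
proof -
  interpret prob_space Q by (rule Q)
  note [measurable_cong] = Q(2)
  interpret pair_sigma_finite Q lborel
    by (intro pair_sigma_finite.intro sigma_finite_measure_axioms lborel.sigma_finite_measure_axioms)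
  have "ennreal (\<integral>w. exp_tail y w \<partial>Q) = (\<integral>\<^sup>+w. ennreal (exp_tail y w) \<partial>Q)"
    using exp_tail_integral(2)[OF assms] by simp
  also have "\<dots> = (\<integral>\<^sup>+w. (\<integral>\<^sup>+u. ennreal (y * exp (- y * u)) * indicator {w..} u * indicator {0<..} w \<partial>lborel) \<partial>Q)"
    using nn_integral_exponential_Ici[OF y]
    by (intro nn_integral_cong) (simp add: nn_integral_multc exp_tail_def indicator_def)
  also have "\<dots> = (\<integral>\<^sup>+w. (\<integral>\<^sup>+u. (if 0 < w \<and> w \<le> u then ennreal (y * exp (- y * u)) else 0) \<partial>lborel) \<partial>Q)"
    by (intro nn_integral_cong) (auto simp: indicator_def)
  also have "\<dots> = (\<integral>\<^sup>+u. (\<integral>\<^sup>+w. (if 0 < w \<and> w \<le> u then ennreal (y * exp (- y * u)) else 0) \<partial>Q) \<partial>lborel)"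
    by (rule Fubini'[symmetric]) measurable
  also have "\<dots> = (\<integral>\<^sup>+u. (\<integral>\<^sup>+w. ennreal (y * exp (- y * u)) * indicator {0<..u} w \<partial>Q) \<partial>lborel)"
    by (intro nn_integral_cong) (auto simp: indicator_def)
  also have "\<dots> = (\<integral>\<^sup>+u. ennreal (y * exp (- y * u)) * ennreal (measure Q {0<..u}) \<partial>lborel)"
    by (intro nn_integral_cong) (simp add: nn_integral_cmult_indicator Q(2) emeasure_eq_measure)
  finally show ?thesis .
qed

text \<open>
  The factor 2 arises because the mass of \<open>(0, u]\<close> is a difference of two values of the distribution
  function.
\<close>

lemma exp_tail_cdf_perturbation_le:
  assumes D: "prob_space D" "sets D = sets borel" and N: "prob_space N" "sets N = sets borel"
    and y: "y > 0"
    and close: "\<And>u. \<bar>measure D {..u} - measure N {..u}\<bar> \<le> \<eta>"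
  shows "(\<integral>w. exp_tail y w \<partial>D) \<le> (\<integral>w. exp_tail y w \<partial>N) + 2 * \<eta>"
proof -
  have \<eta>: "\<eta> \<ge> 0" using close[of 0] by linarith
  have split: "measure Q {0<..u} = measure Q {..u} - measure Q {..0}"
    if "prob_space Q" "sets Q = sets borel" "u \<ge> 0" for Q and u :: real
  proof -
    interpret prob_space Q by fact
    have "measure Q ({..u} - {..0}) = measure Q {..u} - measure Q {..0}"
      using that by (intro finite_measure_Diff) auto
    moreover have "{..u} - {..0} = {0<..u}" by auto
    ultimately show ?thesis by simp
  qed
  have "ennreal (\<integral>w. exp_tail y w \<partial>D)
      = (\<integral>\<^sup>+u. ennreal (y * exp (- y * u)) * ennreal (measure D {0<..u}) \<partial>lborel)"
    by (rule exp_tail_layer_cake[OF D y])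
  also have "\<dots> \<le> (\<integral>\<^sup>+u. ennreal (y * exp (- y * u)) * ennreal (measure N {0<..u})
      + ennreal (2 * \<eta>) * (ennreal (y * exp (- y * u)) * indicator {0..} u) \<partial>lborel)"
  proof (intro nn_integral_mono)
    fix u :: real
    show "ennreal (y * exp (- y * u)) * ennreal (measure D {0<..u})
        \<le> ennreal (y * exp (- y * u)) * ennreal (measure N {0<..u})
          + ennreal (2 * \<eta>) * (ennreal (y * exp (- y * u)) * indicator {0..} u)"
    proof (cases "u \<ge> 0")
      case True
      have "measure D {0<..u} \<le> measure N {0<..u} + 2 * \<eta>"
        unfolding split[OF D True] split[OF N True] using close[of u] close[of 0] by linarith
      then have "y * exp (- y * u) * measure D {0<..u} \<le> y * exp (- y * u) * (measure N {0<..u} + 2 * \<eta>)"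
        using y by (intro mult_left_mono) auto
      then have "ennreal (y * exp (- y * u) * measure D {0<..u})
          \<le> ennreal (y * exp (- y * u) * measure N {0<..u} + 2 * \<eta> * (y * exp (- y * u)))"
        by (intro ennreal_leI) (simp add: algebra_simps)
      then show ?thesis using True y \<eta> by (simp add: ennreal_mult ennreal_plus)
    next
      case False
      then have "{0<..u} = {}" by auto
      then show ?thesis by simp
    qed
  qed
  also have "\<dots> = (\<integral>\<^sup>+u. ennreal (y * exp (- y * u)) * ennreal (measure N {0<..u}) \<partial>lborel) + ennreal (2 * \<eta>)"
  proof -
    have [measurable]: "(\<lambda>u. measure N {0<..u}) \<in> borel_measurable borel"
    proof -
      interpret N: prob_space N by (rule N)
      have "mono (\<lambda>u. measure N {0<..u})"
        by (intro monoI N.finite_measure_mono) (auto simp: N)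
      then show ?thesis by (rule borel_measurable_mono)
    qed
    show ?thesis
      using nn_integral_exponential_Ici[OF y, of 0]
      by (subst nn_integral_add) (auto simp: nn_integral_cmult)
  qed
  also have "\<dots> = ennreal ((\<integral>w. exp_tail y w \<partial>N) + 2 * \<eta>)"
    unfolding exp_tail_layer_cake[OF N y, symmetric]
    using exp_tail_integral(3)[OF N y] \<eta> by (simp add: ennreal_plus)
  finally show ?thesis
    using exp_tail_integral(3)[OF N y] \<eta> by (subst (asm) ennreal_le_iff) auto
qed

lemma exp_tail_cdf_perturbation:
  assumes D: "prob_space D" "sets D = sets borel" and N: "prob_space N" "sets N = sets borel"
    and y: "y > 0"
    and close: "\<And>u. \<bar>measure D {..u} - measure N {..u}\<bar> \<le> \<eta>"
  shows "\<bar>(\<integral>w. exp_tail y w \<partial>D) - (\<integral>w. exp_tail y w \<partial>N)\<bar> \<le> 2 * \<eta>"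
proof -
  have "\<bar>measure N {..u} - measure D {..u}\<bar> \<le> \<eta>" for u using close[of u] by linarith
  from exp_tail_cdf_perturbation_le[OF N D y this] exp_tail_cdf_perturbation_le[OF D N y close]
  show ?thesis by linarith
qed

text \<open>
  For large \<open>y\<close> the weight \<open>exp (- y w)\<close> concentrates at \<open>w = 0\<close>, where the normal density is
  \<open>1 / \<surd>(2 \<pi>)\<close>. The two bounds come from \<open>1 - w\<^sup>2 / 2 \<le> exp (- w\<^sup>2 / 2) \<le> 1\<close> and the second moment
  \<open>2 / y\<^sup>2\<close> of the exponential law.
\<close>

lemma exp_tail_normal:
  assumes y: "y > 0"
  shows "y * sqrt (2 * pi) * (\<integral>w. exp_tail y w \<partial>std_normal_distribution) \<le> 1"
    and "1 - 1 / y\<^sup>2 \<le> y * sqrt (2 * pi) * (\<integral>w. exp_tail y w \<partial>std_normal_distribution)"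
proof -
  let ?N = std_normal_distribution
  let ?E = "\<integral>w. exp_tail y w \<partial>?N"
  let ?c = "1 / sqrt (2 * pi)"
  have N: "prob_space ?N" "sets ?N = sets borel" using std_normal_moments(1) by auto
  note E0 = exp_tail_integral(3)[OF N y]
  have c: "?c > 0" by simp
  have yE: "ennreal (y * ?E) = (\<integral>\<^sup>+w. ennreal (y * (std_normal_density w * exp_tail y w)) \<partial>lborel)"
  proof -
    have "ennreal (y * ?E) = ennreal y * (\<integral>\<^sup>+w. ennreal (exp_tail y w) \<partial>?N)"
      unfolding exp_tail_integral(2)[OF N y] using y E0 by (simp add: ennreal_mult)
    also have "\<dots> = ennreal y * (\<integral>\<^sup>+w. ennreal (std_normal_density w) * ennreal (exp_tail y w) \<partial>lborel)"
      by (subst nn_integral_density) auto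
    also have "\<dots> = (\<integral>\<^sup>+w. ennreal (y * (std_normal_density w * exp_tail y w)) \<partial>lborel)"
      using y exp_tail_bounds(1)[OF y]
      by (subst nn_integral_cmult[symmetric]) (auto simp: ennreal_mult intro!: nn_integral_cong)
    finally show ?thesis .
  qed
  have e0: "(\<integral>\<^sup>+w. ennreal (erlang_density 0 y w) \<partial>lborel) = 1"
    using nn_integral_erlang_ith_moment[OF y, of 0 0] by simp
  have e2: "(\<integral>\<^sup>+w. ennreal (erlang_density 0 y w * w ^ 2) \<partial>lborel) = ennreal (2 / y\<^sup>2)"
    using nn_integral_erlang_ith_moment[OF y, of 0 2] y by (simp add: fact_numeral)
  have dens: "std_normal_density w = ?c * exp (- w\<^sup>2 / 2)" for w by (simp add: std_normal_density_def)
  have "ennreal (y * ?E) \<le> (\<integral>\<^sup>+w. ennreal ?c * ennreal (erlang_density 0 y w) \<partial>lborel)"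
    unfolding yE
  proof (intro nn_integral_mono)
    fix w :: real
    have "y * (std_normal_density w * exp_tail y w) \<le> ?c * erlang_density 0 y w"
    proof (cases "w > 0")
      case True
      then have "std_normal_density w \<le> ?c" unfolding dens using c by (intro mult_left_le) auto
      then have "std_normal_density w * (y * exp (- y * w)) \<le> ?c * (y * exp (- y * w))"
        using y by (intro mult_right_mono) auto
      then show ?thesis using True by (simp add: erlang_density_def exp_tail_def mult_ac)
    next
      case False
      then show ?thesis using y c by (auto simp: exp_tail_def erlang_density_def)
    qed
    then show "ennreal (y * (std_normal_density w * exp_tail y w)) \<le> ennreal ?c * ennreal (erlang_density 0 y w)"
      using c y by (subst ennreal_mult[symmetric]) (auto intro!: ennreal_leI)
  qed
  also have "\<dots> = ennreal ?c" by (simp add: nn_integral_cmult e0)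
  finally have "y * ?E \<le> ?c" using c by (subst (asm) ennreal_le_iff) auto
  then show "y * sqrt (2 * pi) * ?E \<le> 1" by (simp add: field_simps)
  have ennreal_le: "ennreal a * ennreal b \<le> ennreal p + ennreal q * ennreal r"
    if "a * b \<le> p + q * r" "a \<ge> 0" "b \<ge> 0" "p \<ge> 0" "q \<ge> 0" "r \<ge> 0" for a b p q r
    using that ennreal_leI[OF that(1)] by (simp add: ennreal_mult ennreal_plus)
  have "ennreal ?c = (\<integral>\<^sup>+w. ennreal ?c * ennreal (erlang_density 0 y w) \<partial>lborel)"
    by (simp add: nn_integral_cmult e0)
  also have "\<dots> \<le> (\<integral>\<^sup>+w. ennreal (y * (std_normal_density w * exp_tail y w))
      + ennreal (?c / 2) * ennreal (erlang_density 0 y w * w ^ 2) \<partial>lborel)"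
  proof (rule nn_integral_mono_AE)
    \<comment> \<open>At \<open>w = 0\<close> the exponential density is \<open>y\<close> but the weight \<open>exp_tail\<close> vanishes.\<close>
    have "AE w in lborel. w \<noteq> (0::real)" by (rule AE_lborel_singleton)
    then show "AE w in lborel. ennreal ?c * ennreal (erlang_density 0 y w)
        \<le> ennreal (y * (std_normal_density w * exp_tail y w))
          + ennreal (?c / 2) * ennreal (erlang_density 0 y w * w ^ 2)"
    proof eventually_elim
      fix w :: real assume w: "w \<noteq> 0"
      have "?c * erlang_density 0 y w
          \<le> y * (std_normal_density w * exp_tail y w) + ?c / 2 * (erlang_density 0 y w * w ^ 2)"
      proof (cases "w > 0")
        case True
        have "1 + - w\<^sup>2 / 2 \<le> exp (- w\<^sup>2 / 2)" by (rule exp_ge_add_one_self)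
        then have "?c * y * exp (- y * w) * (1 - w\<^sup>2 / 2) \<le> ?c * y * exp (- y * w) * exp (- w\<^sup>2 / 2)"
          using c y by (intro mult_left_mono) auto
        moreover have "b * (y * e) \<le> y * (b * q * e) + b / 2 * (y * e * w\<^sup>2)"
          if "b * y * e * (1 - w\<^sup>2 / 2) \<le> b * y * e * q" for b e q :: real
          using that by (simp add: algebra_simps)
        moreover have "erlang_density 0 y w = y * exp (- y * w)" "exp_tail y w = exp (- y * w)"
          using True by (simp_all add: erlang_density_def exp_tail_def)
        ultimately show ?thesis unfolding dens by (simp only:)
      next
        case False
        then show ?thesis using w by (auto simp: erlang_density_def exp_tail_def)
      qed
      then show "ennreal ?c * ennreal (erlang_density 0 y w)
        \<le> ennreal (y * (std_normal_density w * exp_tail y w))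
          + ennreal (?c / 2) * ennreal (erlang_density 0 y w * w ^ 2)"
        using c y exp_tail_bounds(1)[OF y, of w]
        by (intro ennreal_le) auto
    qed
  qed
  also have "\<dots> = ennreal (y * ?E) + ennreal (?c / 2) * ennreal (2 / y\<^sup>2)"
    by (subst nn_integral_add) (auto simp: nn_integral_cmult yE e2)
  also have "\<dots> = ennreal (y * ?E + ?c / y\<^sup>2)"
    using c y E0 by (subst ennreal_mult[symmetric], simp, simp, subst ennreal_plus[symmetric]) auto
  finally have "?c \<le> y * ?E + ?c / y\<^sup>2"
    using c y E0 by (subst (asm) ennreal_le_iff) auto
  then have "?c * (1 - 1 / y\<^sup>2) \<le> y * ?E" by (simp add: algebra_simps)
  then have "?c * (1 - 1 / y\<^sup>2) * sqrt (2 * pi) \<le> y * ?E * sqrt (2 * pi)"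
    by (intro mult_right_mono) auto
  then show "1 - 1 / y\<^sup>2 \<le> y * sqrt (2 * pi) * ?E" by (simp add: mult_ac)
qed

section \<open>Exponential moments and cumulants\<close>

text \<open>
  Differentiation under the integral sign is reduced to this criterion: a pointwise second-order
  bound with an integrable constant integrates to the required remainder.
\<close>

lemma has_real_derivative_quadratic_remainder:
  fixes f :: "real \<Rightarrow> real"
  assumes \<delta>: "\<delta> > 0" and rem: "\<And>h. \<bar>h\<bar> < \<delta> \<Longrightarrow> \<bar>f (t + h) - f t - h * d\<bar> \<le> K * h\<^sup>2"
  shows "(f has_real_derivative d) (at t)"
proof -
  have "((\<lambda>h. (f (t + h) - f t) / h - d) \<longlongrightarrow> 0) (at 0)"
  proof (rule Lim_null_comparison)
    have "eventually (\<lambda>h. h \<in> {-\<delta><..<\<delta>}) (at (0::real))"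
      using \<delta> by (intro eventually_at_in_open') auto
    moreover have "eventually (\<lambda>h. h \<noteq> 0) (at (0::real))" by (simp add: eventually_at_filter)
    ultimately show "eventually (\<lambda>h. norm ((f (t + h) - f t) / h - d) \<le> \<bar>K\<bar> * \<bar>h\<bar>) (at 0)"
    proof eventually_elim
      case (elim h)
      then have h: "\<bar>h\<bar> < \<delta>" by auto
      have "(f (t + h) - f t) / h - d = (f (t + h) - f t - h * d) / h"
        using elim(2) by (simp add: diff_divide_distrib)
      then have "\<bar>(f (t + h) - f t) / h - d\<bar> = \<bar>f (t + h) - f t - h * d\<bar> / \<bar>h\<bar>"
        by (simp only: abs_divide)
      also have "\<dots> \<le> (K * h\<^sup>2) / \<bar>h\<bar>" by (intro divide_right_mono rem[OF h]) auto
      also have "\<dots> = K * \<bar>h\<bar>" using elim(2) by (auto simp: power2_eq_square abs_if)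
      also have "\<dots> \<le> \<bar>K\<bar> * \<bar>h\<bar>" by (intro mult_right_mono) auto
      finally show ?case by simp
    qed
    show "((\<lambda>h::real. \<bar>K\<bar> * \<bar>h\<bar>) \<longlongrightarrow> 0) (at 0)" by (auto intro!: tendsto_eq_intros)
  qed
  then show ?thesis unfolding DERIV_def by (rule LIM_zero_cancel)
qed

lemma power_le_fact_exp:
  fixes x :: real
  assumes "x \<ge> 0"
  shows "x ^ k \<le> fact k * exp x"
proof -
  have "(\<Sum>n\<in>{k}. x ^ n /\<^sub>R fact n) \<le> (\<Sum>n. x ^ n /\<^sub>R fact n)"
    using assms by (intro sum_le_suminf summable_exp_generic) auto
  then show ?thesis by (simp add: exp_def field_simps)
qed

lemma exp_first_order_remainder:
  fixes x :: real
  shows "\<bar>exp x - 1 - x\<bar> \<le> x\<^sup>2 * exp \<bar>x\<bar>"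
proof -
  obtain t where t: "\<bar>t\<bar> \<le> \<bar>x\<bar>" "exp x = (\<Sum>m<2. x ^ m / fact m) + exp t / fact 2 * x ^ 2"
    using Maclaurin_exp_le[of x 2] by blast
  then have "exp x - 1 - x = exp t / 2 * x\<^sup>2" by (simp add: numeral_2_eq_2)
  then have "\<bar>exp x - 1 - x\<bar> = exp t / 2 * x\<^sup>2" by (simp only: abs_mult) simp
  also have "\<dots> \<le> exp \<bar>x\<bar> * x\<^sup>2"
  proof (rule mult_right_mono)
    have "exp t \<le> exp \<bar>x\<bar>" using t(1) by simp
    then show "exp t / 2 \<le> exp \<bar>x\<bar>" using exp_gt_zero[of "\<bar>x\<bar>"] by linarith
  qed simp
  finally show ?thesis by (simp add: mult.commute)
qed

text \<open>
  Finiteness of the moment generating function near the origin, in the symmetric form that dominates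
  all polynomial factors.
\<close>

locale exponential_moments = prob_space M for M :: "'a measure" +
  fixes Y :: "'a \<Rightarrow> real" and r :: real
  assumes Y_measurable[measurable]: "Y \<in> borel_measurable M"
    and r_pos: "r > 0"
    and exp_integrable: "integrable M (\<lambda>x. exp (r * \<bar>Y x\<bar>))"
begin

text \<open>
  Any power of \<open>|Y|\<close> is absorbed by the spare factor \<open>exp ((r - s) |Y|)\<close>.
\<close>

lemma integrable_abs_power_exp:
  assumes "s < r"
  shows "integrable M (\<lambda>x. \<bar>Y x\<bar> ^ k * exp (s * \<bar>Y x\<bar>))"
proof (rule Bochner_Integration.integrable_bound)
  show "integrable M (\<lambda>x. fact k / (r - s) ^ k * exp (r * \<bar>Y x\<bar>))"
    using exp_integrable by simp
  show "AE x in M. norm (\<bar>Y x\<bar> ^ k * exp (s * \<bar>Y x\<bar>)) \<le> norm (fact k / (r - s) ^ k * exp (r * \<bar>Y x\<bar>))"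
  proof (rule AE_I2)
    fix x
    have "((r - s) * \<bar>Y x\<bar>) ^ k \<le> fact k * exp ((r - s) * \<bar>Y x\<bar>)"
      using assms by (intro power_le_fact_exp) auto
    then have "\<bar>Y x\<bar> ^ k \<le> fact k / (r - s) ^ k * exp ((r - s) * \<bar>Y x\<bar>)"
      using assms by (simp only: power_mult_distrib) (simp add: pos_le_divide_eq mult.commute)
    then have "\<bar>Y x\<bar> ^ k * exp (s * \<bar>Y x\<bar>) \<le> fact k / (r - s) ^ k * exp ((r - s) * \<bar>Y x\<bar>) * exp (s * \<bar>Y x\<bar>)"
      by (intro mult_right_mono) auto
    also have "\<dots> = fact k / (r - s) ^ k * exp (r * \<bar>Y x\<bar>)"
      by (simp add: mult.assoc exp_add[symmetric] algebra_simps)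
    finally show "norm (\<bar>Y x\<bar> ^ k * exp (s * \<bar>Y x\<bar>)) \<le> norm (fact k / (r - s) ^ k * exp (r * \<bar>Y x\<bar>))"
      using assms by simp
  qed
qed measurable

lemma power_exp_bound:
  assumes "\<bar>t\<bar> \<le> s"
  shows "\<bar>Y x ^ k * exp (t * Y x)\<bar> \<le> \<bar>Y x\<bar> ^ k * exp (s * \<bar>Y x\<bar>)"
proof -
  have "t * Y x \<le> \<bar>t\<bar> * \<bar>Y x\<bar>" by (metis abs_ge_self abs_mult)
  also have "\<dots> \<le> s * \<bar>Y x\<bar>" using assms by (intro mult_right_mono) auto
  finally have "exp (t * Y x) \<le> exp (s * \<bar>Y x\<bar>)" by simp
  then have "\<bar>Y x\<bar> ^ k * exp (t * Y x) \<le> \<bar>Y x\<bar> ^ k * exp (s * \<bar>Y x\<bar>)"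
    by (rule mult_left_mono) simp
  then show ?thesis by (simp add: abs_mult power_abs)
qed

lemma integrable_power_exp:
  assumes "\<bar>t\<bar> < r"
  shows "integrable M (\<lambda>x. Y x ^ k * exp (t * Y x))"
proof (rule Bochner_Integration.integrable_bound[OF integrable_abs_power_exp[OF assms, of k]])
  have "norm (Y x ^ k * exp (t * Y x)) \<le> norm (\<bar>Y x\<bar> ^ k * exp (\<bar>t\<bar> * \<bar>Y x\<bar>))" for x
    using power_exp_bound[OF order_refl, of x k t] by (simp add: abs_mult)
  then show "AE x in M. norm (Y x ^ k * exp (t * Y x)) \<le> norm (\<bar>Y x\<bar> ^ k * exp (\<bar>t\<bar> * \<bar>Y x\<bar>))"
    by (rule AE_I2)
qed measurable

text \<open>
  The \<open>k\<close>-th derivative of the moment generating function, defined by the formula that differentiation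
  under the integral yields.
\<close>

definition mgf_deriv :: "nat \<Rightarrow> real \<Rightarrow> real" where
  "mgf_deriv k t = (\<integral>x. Y x ^ k * exp (t * Y x) \<partial>M)"

lemma has_derivative_mgf_deriv:
  assumes t: "\<bar>t\<bar> < r"
  shows "(mgf_deriv k has_real_derivative mgf_deriv (Suc k) t) (at t)"
proof -
  \<comment> \<open>Room on both sides: \<open>t + h\<close> stays below \<open>s\<close> for small \<open>h\<close>, and exponent \<open>s\<close> still allows polynomial factors.\<close>
  define s where "s = (\<bar>t\<bar> + r) / 2"
  have s: "\<bar>t\<bar> < s" "s < r" using t by (auto simp: s_def)
  let ?K = "\<integral>x. \<bar>Y x\<bar> ^ (k + 2) * exp (s * \<bar>Y x\<bar>) \<partial>M"
  show ?thesis
  proof (rule has_real_derivative_quadratic_remainder[where \<delta> = "s - \<bar>t\<bar>" and K = ?K])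
    show "s - \<bar>t\<bar> > 0" using s by simp
    fix h assume h: "\<bar>h\<bar> < s - \<bar>t\<bar>"
    then have th: "\<bar>t + h\<bar> < r" using s by linarith
    let ?R = "\<lambda>x. Y x ^ k * exp ((t + h) * Y x) - Y x ^ k * exp (t * Y x) - h * (Y x ^ Suc k * exp (t * Y x))"
    have iR: "integrable M ?R"
      using integrable_power_exp[OF th, of k] integrable_power_exp[OF t, of k] integrable_power_exp[OF t, of "Suc k"]
      by (intro Bochner_Integration.integrable_diff integrable_mult_right)
    have eq: "mgf_deriv k (t + h) - mgf_deriv k t - h * mgf_deriv (Suc k) t = integral\<^sup>L M ?R"
      unfolding mgf_deriv_def
      using integrable_power_exp[OF th, of k] integrable_power_exp[OF t, of k] integrable_power_exp[OF t, of "Suc k"]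
      by (subst Bochner_Integration.integral_diff, simp, simp)
         (subst Bochner_Integration.integral_diff, auto)
    have bound: "\<bar>?R x\<bar> \<le> h\<^sup>2 * (\<bar>Y x\<bar> ^ (k + 2) * exp (s * \<bar>Y x\<bar>))" for x
    proof -
      have "(\<bar>t\<bar> + \<bar>h\<bar>) * \<bar>Y x\<bar> \<le> s * \<bar>Y x\<bar>" using h by (intro mult_right_mono) auto
      then have exp_le: "exp ((\<bar>t\<bar> + \<bar>h\<bar>) * \<bar>Y x\<bar>) \<le> exp (s * \<bar>Y x\<bar>)" by simp
      have "?R x = Y x ^ k * exp (t * Y x) * (exp (h * Y x) - 1 - h * Y x)"
        by (simp add: exp_add algebra_simps)
      then have "\<bar>?R x\<bar> = \<bar>Y x ^ k * exp (t * Y x)\<bar> * \<bar>exp (h * Y x) - 1 - h * Y x\<bar>"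
        by (simp add: abs_mult)
      also have "\<dots> \<le> (\<bar>Y x\<bar> ^ k * exp (\<bar>t\<bar> * \<bar>Y x\<bar>)) * ((h * Y x)\<^sup>2 * exp \<bar>h * Y x\<bar>)"
        by (intro mult_mono power_exp_bound exp_first_order_remainder) auto
      also have "\<dots> = h\<^sup>2 * (\<bar>Y x\<bar> ^ (k + 2) * exp ((\<bar>t\<bar> + \<bar>h\<bar>) * \<bar>Y x\<bar>))"
      proof -
        have "exp ((\<bar>t\<bar> + \<bar>h\<bar>) * \<bar>Y x\<bar>) = exp (\<bar>t\<bar> * \<bar>Y x\<bar>) * exp \<bar>h * Y x\<bar>"
          by (simp add: exp_add[symmetric] distrib_right abs_mult)
        moreover have "\<bar>Y x\<bar> ^ (k + 2) = \<bar>Y x\<bar> ^ k * (Y x)\<^sup>2" by (simp only: power_add power2_abs)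
        ultimately show ?thesis by (simp add: power_mult_distrib power2_eq_square)
      qed
      also have "\<dots> \<le> h\<^sup>2 * (\<bar>Y x\<bar> ^ (k + 2) * exp (s * \<bar>Y x\<bar>))"
        by (rule mult_left_mono) (use exp_le in \<open>auto intro: mult_left_mono\<close>)
      finally show ?thesis .
    qed
    have iK: "integrable M (\<lambda>x. \<bar>Y x\<bar> ^ (k + 2) * exp (s * \<bar>Y x\<bar>))"
      by (rule integrable_abs_power_exp[OF s(2)])
    have "\<bar>integral\<^sup>L M ?R\<bar> \<le> (\<integral>x. \<bar>?R x\<bar> \<partial>M)" by (rule integral_abs_bound)
    also have "\<dots> \<le> (\<integral>x. h\<^sup>2 * (\<bar>Y x\<bar> ^ (k + 2) * exp (s * \<bar>Y x\<bar>)) \<partial>M)"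
      by (rule integral_mono[OF integrable_abs[OF iR] integrable_mult_right[OF iK] bound])
    also have "\<dots> = h\<^sup>2 * ?K" by (rule integral_mult_right_zero)
    finally show "\<bar>mgf_deriv k (t + h) - mgf_deriv k t - h * mgf_deriv (Suc k) t\<bar> \<le> ?K * h\<^sup>2"
      unfolding eq by (simp only: mult.commute)
  qed
qed

lemma mgf_deriv_0_0 [simp]: "mgf_deriv 0 0 = 1"
  by (simp add: mgf_deriv_def prob_space)

lemma mgf_pos:
  assumes "\<bar>t\<bar> < r"
  shows "mgf_deriv 0 t > 0"
proof -
  have i: "integrable M (\<lambda>x. exp (t * Y x))" using integrable_power_exp[OF assms, of 0] by simp
  have "mgf_deriv 0 t \<ge> 0" by (simp add: mgf_deriv_def)
  moreover have "mgf_deriv 0 t \<noteq> 0"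
  proof
    assume "mgf_deriv 0 t = 0"
    then have "AE x in M. exp (t * Y x) = 0"
      using integral_nonneg_eq_0_iff_AE[OF i] by (simp add: mgf_deriv_def)
    then have "AE x in M. False" by simp
    then show False by (simp add: AE_False emeasure_space_1)
  qed
  ultimately show ?thesis by simp
qed

definition log_mgf :: "real \<Rightarrow> real" where
  "log_mgf t = ln (mgf_deriv 0 t)"

text \<open>
  The first two derivatives of the log-mgf, named for what they are under the tilted law.
\<close>

definition tilted_mean :: "real \<Rightarrow> real" where
  "tilted_mean t = mgf_deriv 1 t / mgf_deriv 0 t"

definition tilted_variance :: "real \<Rightarrow> real" where
  "tilted_variance t = mgf_deriv 2 t / mgf_deriv 0 t - (tilted_mean t)\<^sup>2"

lemma has_derivative_log_mgf:
  assumes "\<bar>t\<bar> < r"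
  shows "(log_mgf has_real_derivative tilted_mean t) (at t)"
proof -
  have "((\<lambda>t. ln (mgf_deriv 0 t)) has_real_derivative 1 / mgf_deriv 0 t * mgf_deriv (Suc 0) t) (at t)"
    by (rule DERIV_chain2[OF DERIV_ln_divide[OF mgf_pos[OF assms]] has_derivative_mgf_deriv[OF assms]])
  then show ?thesis unfolding log_mgf_def[abs_def] tilted_mean_def by simp
qed

lemma has_derivative_tilted_mean:
  assumes "\<bar>t\<bar> < r"
  shows "(tilted_mean has_real_derivative tilted_variance t) (at t)"
proof -
  have "(tilted_mean has_real_derivative
      (mgf_deriv (Suc 1) t * mgf_deriv 0 t - mgf_deriv 1 t * mgf_deriv (Suc 0) t)
        / (mgf_deriv 0 t * mgf_deriv 0 t)) (at t)"
    unfolding tilted_mean_def[abs_def]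
    using mgf_pos[OF assms] by (intro DERIV_divide has_derivative_mgf_deriv[OF assms]) auto
  also have "(mgf_deriv (Suc 1) t * mgf_deriv 0 t - mgf_deriv 1 t * mgf_deriv (Suc 0) t)
        / (mgf_deriv 0 t * mgf_deriv 0 t) = tilted_variance t"
    using mgf_pos[OF assms]
    by (simp add: tilted_variance_def tilted_mean_def diff_divide_distrib power2_eq_square
        numeral_2_eq_2)
  finally show ?thesis .
qed

lemma tilted_variance_differentiable:
  assumes "\<bar>t\<bar> < r"
  shows "\<exists>D. (tilted_variance has_real_derivative D) (at t)"
proof -
  note d = has_derivative_mgf_deriv[OF assms]
  have "((\<lambda>t. mgf_deriv 2 t / mgf_deriv 0 t) has_real_derivative
      (mgf_deriv (Suc 2) t * mgf_deriv 0 t - mgf_deriv 2 t * mgf_deriv (Suc 0) t)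
        / (mgf_deriv 0 t * mgf_deriv 0 t)) (at t)"
    using mgf_pos[OF assms] by (intro DERIV_divide d) auto
  from DERIV_diff[OF this DERIV_power[OF has_derivative_tilted_mean[OF assms], of 2]]
  show ?thesis unfolding tilted_variance_def[abs_def] by blast
qed

lemma tilted_mean_0: "tilted_mean 0 = expectation Y"
  by (simp add: tilted_mean_def) (simp add: mgf_deriv_def)

lemma tilted_variance_0: "tilted_variance 0 = variance Y"
proof -
  have "integrable M Y" "integrable M (\<lambda>x. (Y x)\<^sup>2)"
    using integrable_power_exp[of 0 1] integrable_power_exp[of 0 2] r_pos by auto
  then show ?thesis
    unfolding tilted_variance_def tilted_mean_0 by (subst variance_eq) (auto simp: mgf_deriv_def prob_space)
qed

end

section \<open>Exponential tilting\<close>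

context exponential_moments
begin

definition tilted :: "real \<Rightarrow> 'a measure" where
  "tilted t = density M (\<lambda>x. ennreal (exp (t * Y x) / mgf_deriv 0 t))"

lemma space_tilted [simp]: "space (tilted t) = space M"
  and sets_tilted [simp, measurable_cong]: "sets (tilted t) = sets M"
  by (simp_all add: tilted_def)

lemma Y_measurable_tilted [measurable]: "Y \<in> borel_measurable (tilted t)"
  by (simp add: tilted_def)

lemma integral_tilted:
  assumes t: "\<bar>t\<bar> < r" and [measurable]: "g \<in> borel_measurable M"
  shows "(\<integral>x. g x \<partial>tilted t) = (\<integral>x. g x * exp (t * Y x) \<partial>M) / mgf_deriv 0 t"
    and "integrable (tilted t) g \<longleftrightarrow> integrable M (\<lambda>x. g x * exp (t * Y x))"
proof -
  note pos = mgf_pos[OF t]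
  have "(\<integral>x. g x \<partial>tilted t) = (\<integral>x. exp (t * Y x) / mgf_deriv 0 t * g x \<partial>M)"
    unfolding tilted_def using pos by (intro integral_real_density) auto
  also have "\<dots> = (\<integral>x. g x * exp (t * Y x) / mgf_deriv 0 t \<partial>M)"
    by (intro Bochner_Integration.integral_cong) auto
  finally show "(\<integral>x. g x \<partial>tilted t) = (\<integral>x. g x * exp (t * Y x) \<partial>M) / mgf_deriv 0 t" by simp
  have "integrable (tilted t) g \<longleftrightarrow> integrable M (\<lambda>x. exp (t * Y x) / mgf_deriv 0 t * g x)"
    unfolding tilted_def using pos by (intro integrable_real_density) auto
  also have "\<dots> \<longleftrightarrow> integrable M (\<lambda>x. 1 / mgf_deriv 0 t * (g x * exp (t * Y x)))"
    by (intro Bochner_Integration.integrable_cong) auto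
  also have "\<dots> \<longleftrightarrow> integrable M (\<lambda>x. g x * exp (t * Y x))"
    using pos by (subst integrable_mult_left_iff) auto
  finally show "integrable (tilted t) g \<longleftrightarrow> integrable M (\<lambda>x. g x * exp (t * Y x))" .
qed

lemma prob_space_tilted:
  assumes t: "\<bar>t\<bar> < r"
  shows "prob_space (tilted t)"
proof
  note pos = mgf_pos[OF t]
  have i: "integrable M (\<lambda>x. exp (t * Y x) / mgf_deriv 0 t)"
    using integrable_power_exp[OF t, of 0] by simp
  have "emeasure (tilted t) (space (tilted t)) = (\<integral>\<^sup>+x. ennreal (exp (t * Y x) / mgf_deriv 0 t) \<partial>M)"
    unfolding tilted_def by (subst emeasure_density) (auto intro!: nn_integral_cong)
  also have "\<dots> = ennreal (\<integral>x. exp (t * Y x) / mgf_deriv 0 t \<partial>M)"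
    using pos by (intro nn_integral_eq_integral[OF i]) auto
  also have "(\<integral>x. exp (t * Y x) / mgf_deriv 0 t \<partial>M) = mgf_deriv 0 t / mgf_deriv 0 t"
    by (simp add: mgf_deriv_def)
  finally show "emeasure (tilted t) (space (tilted t)) = 1" using pos by simp
qed

lemma tilted_moment:
  assumes t: "\<bar>t\<bar> < r"
  shows "integrable (tilted t) (\<lambda>x. Y x ^ k)"
    and "(\<integral>x. Y x ^ k \<partial>tilted t) = mgf_deriv k t / mgf_deriv 0 t"
  using integral_tilted[OF t, of "\<lambda>x. Y x ^ k"] integrable_power_exp[OF t, of k]
  by (simp_all add: mgf_deriv_def)

definition standardized :: "real \<Rightarrow> 'a \<Rightarrow> real" where
  "standardized t x = (Y x - tilted_mean t) / sqrt (tilted_variance t)"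

lemma standardized_measurable [measurable]: "standardized t \<in> borel_measurable M"
  unfolding standardized_def[abs_def] by measurable

lemma standardized_measurable_tilted: "standardized t \<in> borel_measurable (tilted t)"
  unfolding standardized_def[abs_def] by measurable

text \<open>
  A bound for the third absolute moment of the standardized variable under the tilted law. Apart from
  quantities that are continuous in \<open>t\<close> it involves only the fixed exponent \<open>s\<close>, so it stays bounded
  as \<open>t \<rightarrow> 0\<close>; this keeps the rate of the central limit theorem uniform in the tilt.
\<close>

definition third_moment_bound :: "real \<Rightarrow> real \<Rightarrow> real" where
  "third_moment_bound s t = 8 * ((\<integral>x. \<bar>Y x\<bar> ^ 3 * exp (s * \<bar>Y x\<bar>) \<partial>M) / mgf_deriv 0 t + \<bar>tilted_mean t\<bar> ^ 3)
     / sqrt (tilted_variance t) ^ 3"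

lemma standardized_moments:
  assumes t: "\<bar>t\<bar> \<le> s" and s: "s < r" and v: "tilted_variance t > 0"
  shows "(\<integral>x. standardized t x \<partial>tilted t) = 0"
    and "(\<integral>x. (standardized t x)\<^sup>2 \<partial>tilted t) = 1"
    and "integrable (tilted t) (\<lambda>x. \<bar>standardized t x\<bar> ^ 3)"
    and "(\<integral>x. \<bar>standardized t x\<bar> ^ 3 \<partial>tilted t) \<le> third_moment_bound s t"
proof -
  have tr: "\<bar>t\<bar> < r" using t s by linarith
  interpret T: prob_space "tilted t" by (rule prob_space_tilted[OF tr])
  have prob_1: "measure (tilted t) (space M) = 1" using T.prob_space by simp
  let ?m = "tilted_mean t" and ?\<sigma> = "sqrt (tilted_variance t)"
  have \<sigma>: "?\<sigma> > 0" "?\<sigma>\<^sup>2 = tilted_variance t" using v by auto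
  have i1: "integrable (tilted t) Y" using tilted_moment(1)[OF tr, of 1] by simp
  have i2: "integrable (tilted t) (\<lambda>x. (Y x)\<^sup>2)" by (rule tilted_moment(1)[OF tr])
  have m1: "(\<integral>x. Y x \<partial>tilted t) = ?m"
    using tilted_moment(2)[OF tr, of 1] by (simp add: tilted_mean_def)
  have m2: "(\<integral>x. (Y x)\<^sup>2 \<partial>tilted t) = tilted_variance t + ?m\<^sup>2"
    using tilted_moment(2)[OF tr, of 2] by (simp add: tilted_variance_def)
  show "(\<integral>x. standardized t x \<partial>tilted t) = 0"
    unfolding standardized_def using i1 m1 by (simp add: prob_1)
  have "(\<integral>x. (standardized t x)\<^sup>2 \<partial>tilted t) = (\<integral>x. ((Y x)\<^sup>2 - 2 * ?m * Y x + ?m\<^sup>2) / ?\<sigma>\<^sup>2 \<partial>tilted t)"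
    unfolding standardized_def
    by (intro Bochner_Integration.integral_cong refl)
       (simp only: power_divide power2_diff, simp add: algebra_simps)
  also have "\<dots> = ((tilted_variance t + ?m\<^sup>2) - 2 * ?m * ?m + ?m\<^sup>2) / ?\<sigma>\<^sup>2"
    using i1 i2 m1 m2 by (simp add: prob_1)
  also have "\<dots> = 1" using v \<sigma> by (simp add: power2_eq_square)
  finally show "(\<integral>x. (standardized t x)\<^sup>2 \<partial>tilted t) = 1" .
  let ?A = "\<integral>x. \<bar>Y x\<bar> ^ 3 * exp (s * \<bar>Y x\<bar>) \<partial>M"
  have iA: "integrable M (\<lambda>x. \<bar>Y x\<bar> ^ 3 * exp (s * \<bar>Y x\<bar>))"
    by (rule integrable_abs_power_exp[OF s])
  have le: "\<bar>Y x\<bar> ^ 3 * exp (t * Y x) \<le> \<bar>Y x\<bar> ^ 3 * exp (s * \<bar>Y x\<bar>)" for x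
    using power_exp_bound[OF t, of x 3] by (simp add: abs_mult power_abs)
  have ia: "integrable M (\<lambda>x. \<bar>Y x\<bar> ^ 3 * exp (t * Y x))"
  proof (rule Bochner_Integration.integrable_bound[OF iA])
    show "AE x in M. norm (\<bar>Y x\<bar> ^ 3 * exp (t * Y x)) \<le> norm (\<bar>Y x\<bar> ^ 3 * exp (s * \<bar>Y x\<bar>))"
      using le by (intro AE_I2) (simp add: abs_mult)
  qed measurable
  have i3: "integrable (tilted t) (\<lambda>x. \<bar>Y x\<bar> ^ 3)"
    using integral_tilted(2)[OF tr, of "\<lambda>x. \<bar>Y x\<bar> ^ 3"] ia by simp
  have "(\<integral>x. \<bar>Y x\<bar> ^ 3 * exp (t * Y x) \<partial>M) \<le> ?A"
    by (rule integral_mono[OF ia iA le])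
  then have m3: "(\<integral>x. \<bar>Y x\<bar> ^ 3 \<partial>tilted t) \<le> ?A / mgf_deriv 0 t"
    using integral_tilted(1)[OF tr, of "\<lambda>x. \<bar>Y x\<bar> ^ 3"] mgf_pos[OF tr]
    by (simp add: divide_right_mono)
  have cube: "\<bar>y - m\<bar> ^ 3 \<le> 8 * (\<bar>y\<bar> ^ 3 + \<bar>m\<bar> ^ 3)" for y m :: real
  proof -
    have "\<bar>y - m\<bar> ^ 3 \<le> (2 * max \<bar>y\<bar> \<bar>m\<bar>) ^ 3" by (intro power_mono) auto
    also have "\<dots> = 8 * max (\<bar>y\<bar> ^ 3) (\<bar>m\<bar> ^ 3)"
      by (simp add: power_mult_distrib max_def power_mono_iff)
    also have "\<dots> \<le> 8 * (\<bar>y\<bar> ^ 3 + \<bar>m\<bar> ^ 3)" by (simp add: max_def)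
    finally show ?thesis .
  qed
  let ?B = "\<lambda>x. 8 * (\<bar>Y x\<bar> ^ 3 + \<bar>?m\<bar> ^ 3) / ?\<sigma> ^ 3"
  have iB: "integrable (tilted t) ?B"
    using i3 by simp
  have dom: "\<bar>standardized t x\<bar> ^ 3 \<le> ?B x" for x
  proof -
    have "\<bar>standardized t x\<bar> ^ 3 = \<bar>Y x - ?m\<bar> ^ 3 / ?\<sigma> ^ 3"
      using \<sigma>(1) unfolding standardized_def by (simp add: abs_divide power_divide)
    also have "\<dots> \<le> ?B x" using \<sigma>(1) by (intro divide_right_mono cube) auto
    finally show ?thesis .
  qed
  show iZ: "integrable (tilted t) (\<lambda>x. \<bar>standardized t x\<bar> ^ 3)"
  proof (rule Bochner_Integration.integrable_bound[OF iB])
    have "norm (\<bar>standardized t x\<bar> ^ 3) \<le> norm (?B x)" for x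
      using order_trans[OF dom[of x] abs_ge_self[of "?B x"]] by simp
    then show "AE x in tilted t. norm (\<bar>standardized t x\<bar> ^ 3) \<le> norm (?B x)"
      by (rule AE_I2)
  qed measurable
  have "(\<integral>x. \<bar>standardized t x\<bar> ^ 3 \<partial>tilted t) \<le> (\<integral>x. ?B x \<partial>tilted t)"
    by (rule integral_mono[OF iZ iB dom])
  also have "\<dots> = 8 * ((\<integral>x. \<bar>Y x\<bar> ^ 3 \<partial>tilted t) + \<bar>?m\<bar> ^ 3) / ?\<sigma> ^ 3"
    using i3 by (simp add: prob_1)
  also have "\<dots> \<le> third_moment_bound s t"
    unfolding third_moment_bound_def using m3 \<sigma>(1)
    by (intro divide_right_mono mult_left_mono add_right_mono) auto
  finally show "(\<integral>x. \<bar>standardized t x\<bar> ^ 3 \<partial>tilted t) \<le> third_moment_bound s t" .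
qed

lemma standardized_sum_measurable:
  "(\<lambda>\<omega>. (\<Sum>i=1..n. standardized t (\<omega> i)) / c) \<in> borel_measurable (PiM {1..n} (\<lambda>_. tilted t))"
proof -
  have "(\<lambda>\<omega>. standardized t (\<omega> i)) \<in> borel_measurable (PiM {1..n} (\<lambda>_. tilted t))" if "i \<in> {1..n}" for i
    by (rule measurable_compose[where N = "tilted t"])
       (use that standardized_measurable_tilted in \<open>auto intro: measurable_component_singleton\<close>)
  then show ?thesis by (intro borel_measurable_divide borel_measurable_sum borel_measurable_const)
qed

lemma PiM_tilted:
  assumes t: "\<bar>t\<bar> < r"
  shows "PiM {1..n} (\<lambda>_. tilted t)
    = density (PiM {1..n} (\<lambda>_. M)) (\<lambda>\<omega>. ennreal (exp (t * (\<Sum>i=1..n. Y (\<omega> i))) / mgf_deriv 0 t ^ n))"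
proof -
  interpret T: prob_space "tilted t" by (rule prob_space_tilted[OF t])
  have M: "product_sigma_finite (\<lambda>_::nat. M)" and D: "product_sigma_finite (\<lambda>_::nat. tilted t)"
    by (auto intro!: product_sigma_finite.intro sigma_finite_measure_axioms T.sigma_finite_measure_axioms)
  have "PiM {1..n} (\<lambda>_. tilted t) = density (PiM {1..n} (\<lambda>_. M))
      (\<lambda>\<omega>. \<Prod>i=1..n. ennreal (exp (t * Y (\<omega> i)) / mgf_deriv 0 t))"
    unfolding tilted_def
    by (rule PiM_density[OF _ M]) (use D in \<open>auto simp: tilted_def\<close>)
  also have "(\<lambda>\<omega>. \<Prod>i=1..n. ennreal (exp (t * Y (\<omega> i)) / mgf_deriv 0 t))
      = (\<lambda>\<omega>. ennreal (exp (t * (\<Sum>i=1..n. Y (\<omega> i))) / mgf_deriv 0 t ^ n))"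
    using mgf_pos[OF t]
    by (subst prod_ennreal) (auto simp: prod_dividef exp_sum sum_distrib_left)
  finally show ?thesis .
qed

definition upper_tail :: "nat \<Rightarrow> real \<Rightarrow> real" where
  "upper_tail n l = measure (PiM {1..n} (\<lambda>_. M)) {\<omega> \<in> space (PiM {1..n} (\<lambda>_. M)). (\<Sum>i=1..n. Y (\<omega> i)) > real n * l}"

text \<open>
  The change of measure. The likelihood ratio on the sample is \<open>exp (n K(t) - t S)\<close>; on the event
  \<open>S > n K'(t)\<close> the exponent splits into its value at the threshold and \<open>- t (S - n K'(t)) = - y W\<close>.
\<close>

lemma upper_tail_tilted:
  assumes t: "\<bar>t\<bar> < r" and v: "tilted_variance t > 0" and n: "n \<ge> 1"
  defines "W \<equiv> \<lambda>\<omega>. (\<Sum>i=1..n. standardized t (\<omega> i)) / sqrt n"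
  shows "upper_tail n (tilted_mean t) * exp (n * (t * tilted_mean t - log_mgf t))
    = (\<integral>w. exp_tail (t * sqrt (tilted_variance t) * sqrt n) w \<partial>distr (PiM {1..n} (\<lambda>_. tilted t)) borel W)"
proof -
  let ?P = "PiM {1..n} (\<lambda>_. M)" and ?T = "PiM {1..n} (\<lambda>_. tilted t)"
  let ?m = "tilted_mean t" and ?\<sigma> = "sqrt (tilted_variance t)" and ?L = "mgf_deriv 0 t"
  let ?y = "t * ?\<sigma> * sqrt n"
  let ?S = "\<lambda>\<omega>. \<Sum>i=1..n. Y (\<omega> i)"
  let ?A = "{\<omega> \<in> space ?P. ?S \<omega> > real n * ?m}"
  note L = mgf_pos[OF t]
  have \<sigma>: "?\<sigma> > 0" using v by simp
  have scale: "?\<sigma> * sqrt n > 0" using \<sigma> n by simp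
  have Ws: "W \<omega> = (?S \<omega> - n * ?m) / (?\<sigma> * sqrt n)" for \<omega>
    unfolding W_def standardized_def
    by (simp add: sum_divide_distrib[symmetric] sum_subtractf)
  have WT: "W \<in> borel_measurable ?T" unfolding W_def by (rule standardized_sum_measurable)
  have WP[measurable]: "W \<in> borel_measurable ?P" unfolding W_def by measurable
  have A: "?A \<in> sets ?P" by measurable
  have "(\<integral>w. exp_tail ?y w \<partial>distr ?T borel W) = (\<integral>\<omega>. exp_tail ?y (W \<omega>) \<partial>?T)"
    by (rule integral_distr[OF WT exp_tail_measurable])
  also have "\<dots> = (\<integral>\<omega>. exp (t * ?S \<omega>) / ?L ^ n * exp_tail ?y (W \<omega>) \<partial>?P)"
    unfolding PiM_tilted[OF t] using L by (intro integral_real_density) (auto simp del: One_nat_def)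
  also have "\<dots> = (\<integral>\<omega>. exp (n * (t * ?m - log_mgf t)) * indicator ?A \<omega> \<partial>?P)"
  proof (rule Bochner_Integration.integral_cong[OF refl])
    fix \<omega> assume \<omega>: "\<omega> \<in> space ?P"
    have pos: "W \<omega> > 0 \<longleftrightarrow> ?S \<omega> > n * ?m"
      unfolding Ws pos_less_divide_eq[OF scale] by simp
    have "?y * W \<omega> = t * (?S \<omega> - n * ?m)"
      using \<sigma> n by (simp add: Ws)
    then have "exp (t * ?S \<omega>) / ?L ^ n * exp (- ?y * W \<omega>) = exp (t * ?S \<omega>) * exp (- (t * (?S \<omega> - n * ?m))) / ?L ^ n"
      by simp
    also have "\<dots> = exp (n * (t * ?m)) / ?L ^ n"
      by (simp add: exp_add[symmetric] algebra_simps)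
    also have "\<dots> = exp (n * (t * ?m - log_mgf t))"
      using L by (simp add: log_mgf_def exp_of_nat_mult exp_diff right_diff_distrib)
    finally show "exp (t * ?S \<omega>) / ?L ^ n * exp_tail ?y (W \<omega>) = exp (n * (t * ?m - log_mgf t)) * indicator ?A \<omega>"
      using \<omega> pos by (auto simp: exp_tail_def indicator_def)
  qed
  also have "\<dots> = exp (n * (t * ?m - log_mgf t)) * measure ?P ?A"
    using A by simp
  finally show ?thesis unfolding upper_tail_def by (simp only: mult.commute)
qed

text \<open>
  Non-asymptotic form of the result at thresholds of the form \<open>K'(t)\<close>: the first error term comes from
  the normal integral, the second from the normal approximation.
\<close>

lemma upper_tail_estimate:
  assumes t: "0 < t" "t \<le> s" and s: "s < r" and v: "tilted_variance t > 0" and n: "n \<ge> 1"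
  defines "y \<equiv> t * sqrt (tilted_variance t) * sqrt n"
  shows "\<bar>y * sqrt (2 * pi) * (upper_tail n (tilted_mean t) * exp (n * (t * tilted_mean t - log_mgf t))) - 1\<bar>
    \<le> 1 / y\<^sup>2 + 2 * sqrt (2 * pi) * (4 * third_moment_bound s t + 10) * (y * n powr (- (1/8)))"
proof -
  have tr: "\<bar>t\<bar> < r" and ts: "\<bar>t\<bar> \<le> s" using t s by auto
  let ?T = "PiM {1..n} (\<lambda>_. tilted t)"
  let ?W = "\<lambda>\<omega>. (\<Sum>i=1..n. standardized t (\<omega> i)) / sqrt n"
  let ?D = "distr ?T borel ?W" and ?N = std_normal_distribution
  let ?E = "\<integral>w. exp_tail y w \<partial>?D" and ?F = "\<integral>w. exp_tail y w \<partial>?N"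
  let ?c = "sqrt (2 * pi)"
  interpret T: prob_space ?T by (intro prob_space_PiM prob_space_tilted[OF tr])
  have D: "prob_space ?D" "sets ?D = sets borel" using T.prob_space_distr[OF standardized_sum_measurable] by simp_all
  have N: "prob_space ?N" "sets ?N = sets borel" using std_normal_moments(1) by auto
  have y: "y > 0" unfolding y_def using t v n by simp
  note mom = standardized_moments[OF ts s v]
  define \<eta> where "\<eta> = (4 * third_moment_bound s t + 10) * real n powr (- (1/8))"
  have close: "\<bar>measure ?D {..u} - measure ?N {..u}\<bar> \<le> \<eta>" for u
  proof -
    have "\<bar>measure ?D {..u} - measure ?N {..u}\<bar>
        \<le> (4 * (\<integral>x. \<bar>standardized t x\<bar> ^ 3 \<partial>tilted t) + 10) * real n powr (- (1/8))"
      by (rule polynomial_Berry_Esseen[OF prob_space_tilted[OF tr] standardized_measurable_tilted mom(3,1,2) n])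
    also have "\<dots> \<le> \<eta>" unfolding \<eta>_def using mom(4) by (intro mult_right_mono) auto
    finally show ?thesis .
  qed
  have "\<bar>?E - ?F\<bar> \<le> 2 * \<eta>" by (rule exp_tail_cdf_perturbation[OF D N y close])
  then have "\<bar>y * ?c * (?E - ?F)\<bar> \<le> y * ?c * (2 * \<eta>)"
    using y by (simp add: abs_mult)
  moreover have "\<bar>y * ?c * ?F - 1\<bar> \<le> 1 / y\<^sup>2"
    using exp_tail_normal[OF y] by (simp add: abs_le_iff)
  moreover have "y * ?c * ?E - 1 = y * ?c * (?E - ?F) + (y * ?c * ?F - 1)"
    by (simp add: algebra_simps)
  ultimately have "\<bar>y * ?c * ?E - 1\<bar> \<le> 1 / y\<^sup>2 + y * ?c * (2 * \<eta>)" by linarith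
  then show ?thesis
    using upper_tail_tilted[OF tr v n] unfolding y_def[symmetric] \<eta>_def by (simp add: mult_ac)
qed

end

section \<open>One-sided moderate deviations\<close>

context exponential_moments
begin

text \<open>
  With \<open>q(t) = t K'(t) - K(t) - K'(t)\<^sup>2 / (2 v)\<close> one has \<open>q(0) = 0\<close> and
  \<open>q'(t) = K''(t) (t - K'(t) / v)\<close>, which is \<open>O(t\<^sup>2)\<close> because \<open>K'(t) = v t + O(t\<^sup>2)\<close>. Hence the rate
  function \<open>t K'(t) - K(t)\<close> agrees with the Gaussian one up to \<open>O(t\<^sup>3)\<close>. Both estimates
  come from the mean value theorem.
\<close>

lemma cumulant_expansion:
  assumes mean: "expectation Y = 0" and v0: "tilted_variance 0 = v" "v > 0"
  obtains C \<delta> where "C > 0" "0 < \<delta>" "\<delta> < r"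
    and "\<And>t. 0 \<le> t \<Longrightarrow> t \<le> \<delta> \<Longrightarrow> \<bar>tilted_mean t - v * t\<bar> \<le> C * t\<^sup>2"
    and "\<And>t. 0 \<le> t \<Longrightarrow> t \<le> \<delta> \<Longrightarrow>
      \<bar>t * tilted_mean t - log_mgf t - (tilted_mean t)\<^sup>2 / (2 * v)\<bar> \<le> C * t ^ 3"
proof -
  obtain D where D: "(tilted_variance has_real_derivative D) (at 0)"
    using tilted_variance_differentiable[of 0] r_pos by auto
  \<comment> \<open>Differentiability of \<open>K''\<close> at 0 alone bounds its increments from 0 linearly.\<close>
  define B where "B = \<bar>D\<bar> + 1"
  have B: "B > 0" by (simp add: B_def)
  have "((\<lambda>h. (tilted_variance h - v) / h) \<longlongrightarrow> D) (at 0)"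
    using D unfolding DERIV_def v0(1) by simp
  then have "eventually (\<lambda>h. dist ((tilted_variance h - v) / h) D < 1) (at 0)"
    by (rule tendstoD) simp
  then obtain d where d: "d > 0" "\<And>h. h \<noteq> 0 \<Longrightarrow> \<bar>h\<bar> < d \<Longrightarrow> dist ((tilted_variance h - v) / h) D < 1"
    unfolding eventually_at by (auto simp: dist_real_def)
  define \<delta> where "\<delta> = min (d / 2) (r / 2)"
  have \<delta>: "0 < \<delta>" "\<delta> < r" "\<delta> < d" using d r_pos by (auto simp: \<delta>_def min_def)
  have var: "\<bar>tilted_variance t - v\<bar> \<le> B * t" if "0 \<le> t" "t \<le> \<delta>" for t
  proof (cases "t = 0")
    case False
    then have "dist ((tilted_variance t - v) / t) D < 1" using that \<delta> by (intro d(2)) auto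
    then have "\<bar>(tilted_variance t - v) / t\<bar> \<le> B" unfolding B_def dist_real_def by linarith
    then show ?thesis using False that by (simp add: abs_divide pos_divide_le_eq)
  qed (use v0 in simp)
  have mean_bound: "\<bar>tilted_mean t - v * t\<bar> \<le> B * t\<^sup>2" if t: "0 \<le> t" "t \<le> \<delta>" for t
  proof (cases "t = 0")
    case False
    have "\<exists>z. 0 < z \<and> z < t \<and> (tilted_mean t - v * t) - (tilted_mean 0 - v * 0) = (t - 0) * (tilted_variance z - v)"
    proof (rule MVT2)
      show "0 < t" using False t by simp
      fix x assume "0 \<le> x" "x \<le> t"
      then have "\<bar>x\<bar> < r" using t \<delta> by simp
      from DERIV_diff[OF has_derivative_tilted_mean[OF this] DERIV_cmult_Id[of v]]
      show "((\<lambda>t. tilted_mean t - v * t) has_real_derivative tilted_variance x - v) (at x)" .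
    qed
    then obtain z where z: "0 < z" "z < t" "tilted_mean t - v * t = t * (tilted_variance z - v)"
      by (auto simp: tilted_mean_0 mean)
    have "\<bar>tilted_mean t - v * t\<bar> = t * \<bar>tilted_variance z - v\<bar>"
      using z t by (simp add: abs_mult)
    also have "\<dots> \<le> t * (B * t)"
    proof (rule mult_left_mono)
      have "\<bar>tilted_variance z - v\<bar> \<le> B * z" using z t by (intro var) auto
      also have "\<dots> \<le> B * t" using z B by (intro mult_left_mono) auto
      finally show "\<bar>tilted_variance z - v\<bar> \<le> B * t" .
    qed (use t in simp)
    finally show ?thesis by (simp add: power2_eq_square mult_ac)
  qed (simp add: tilted_mean_0 mean)
  define q where "q t = t * tilted_mean t - log_mgf t - (tilted_mean t)\<^sup>2 / (2 * v)" for t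
  define V where "V = v + B * \<delta>"
  have V: "V > 0" using v0 B \<delta> by (simp add: V_def add_pos_pos)
  have q_bound: "\<bar>q t\<bar> \<le> V * B / v * t ^ 3" if t: "0 \<le> t" "t \<le> \<delta>" for t
  proof (cases "t = 0")
    case True
    then show ?thesis by (simp add: q_def tilted_mean_0 mean log_mgf_def)
  next
    case False
    have "\<exists>z. 0 < z \<and> z < t \<and> q t - q 0 = (t - 0) * (tilted_variance z * (z - tilted_mean z / v))"
    proof (rule MVT2)
      show "0 < t" using False t by simp
      fix x assume "0 \<le> x" "x \<le> t"
      then have x: "\<bar>x\<bar> < r" using t \<delta> by simp
      note m = has_derivative_tilted_mean[OF x] and k = has_derivative_log_mgf[OF x]
      have "(q has_real_derivative ((1 * tilted_mean x + tilted_variance x * x) - tilted_mean x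
          - (of_nat 2 * (tilted_variance x * tilted_mean x ^ (2 - Suc 0))) / (2 * v))) (at x)"
        unfolding q_def[abs_def]
        by (intro DERIV_diff DERIV_mult DERIV_ident DERIV_cdivide DERIV_power m k)
      also have "((1 * tilted_mean x + tilted_variance x * x) - tilted_mean x
          - (of_nat 2 * (tilted_variance x * tilted_mean x ^ (2 - Suc 0))) / (2 * v))
          = tilted_variance x * (x - tilted_mean x / v)"
        using v0 by (simp add: algebra_simps)
      finally show "(q has_real_derivative tilted_variance x * (x - tilted_mean x / v)) (at x)" .
    qed
    then obtain z where z: "0 < z" "z < t" "q t = t * (tilted_variance z * (z - tilted_mean z / v))"
      by (auto simp: q_def tilted_mean_0 mean log_mgf_def)
    have z\<delta>: "0 \<le> z" "z \<le> \<delta>" using z t by auto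
    have "z - tilted_mean z / v = - (tilted_mean z - v * z) / v"
      using v0 by (simp add: field_simps)
    then have "\<bar>z - tilted_mean z / v\<bar> = \<bar>tilted_mean z - v * z\<bar> / v"
      using v0 by (simp only: abs_divide abs_minus_cancel)
    also have "\<dots> \<le> B * z\<^sup>2 / v" using v0 by (intro divide_right_mono mean_bound z\<delta>) auto
    also have "\<dots> \<le> B * t\<^sup>2 / v"
      using v0 B z by (intro divide_right_mono mult_left_mono power_mono) auto
    finally have 1: "\<bar>z - tilted_mean z / v\<bar> \<le> B * t\<^sup>2 / v" .
    have "B * z \<le> B * \<delta>" using z\<delta> B by (intro mult_left_mono) auto
    then have 2: "\<bar>tilted_variance z\<bar> \<le> V"
      using var[OF z\<delta>] v0 unfolding V_def by linarith
    have "\<bar>q t\<bar> = t * (\<bar>tilted_variance z\<bar> * \<bar>z - tilted_mean z / v\<bar>)"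
      unfolding z(3) using t by (simp add: abs_mult)
    also have "\<dots> \<le> t * (V * (B * t\<^sup>2 / v))"
      using 1 2 t V by (intro mult_left_mono mult_mono) auto
    also have "\<dots> = V * B / v * t ^ 3" by (simp add: power2_eq_square power3_eq_cube mult_ac)
    finally show ?thesis .
  qed
  show thesis
  proof (rule that[of "max B (V * B / v)" \<delta>])
    show "max B (V * B / v) > 0" using B by simp
    show "0 < \<delta>" "\<delta> < r" by (fact \<delta>)+
    fix t assume t: "0 \<le> t" "t \<le> \<delta>"
    show "\<bar>tilted_mean t - v * t\<bar> \<le> max B (V * B / v) * t\<^sup>2"
      by (rule order_trans[OF mean_bound[OF t]]) (intro mult_right_mono, auto)
    show "\<bar>t * tilted_mean t - log_mgf t - (tilted_mean t)\<^sup>2 / (2 * v)\<bar> \<le> max B (V * B / v) * t ^ 3"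
      unfolding q_def[symmetric]
      by (rule order_trans[OF q_bound[OF t]]) (intro mult_right_mono, use t in auto)
  qed
qed

text \<open>
  The intermediate value theorem: for small \<open>l\<close> the quadratic error in \<open>K'(t) = v t + O(t\<^sup>2)\<close> is at most
  half of the linear term, so \<open>K'\<close> has reached \<open>l\<close> at the latest at \<open>t = 2 l / v\<close>.
\<close>

lemma saddle_point_exists:
  assumes mean: "expectation Y = 0" and v0: "tilted_variance 0 = v" "v > 0"
  obtains l0 where "l0 > 0"
    and "\<And>l. 0 < l \<Longrightarrow> l < l0 \<Longrightarrow> \<exists>t. 0 < t \<and> t \<le> 2 * l / v \<and> tilted_mean t = l"
proof -
  obtain C \<delta> where C: "C > 0" and \<delta>: "0 < \<delta>" "\<delta> < r"
    and m: "\<And>t. 0 \<le> t \<Longrightarrow> t \<le> \<delta> \<Longrightarrow> \<bar>tilted_mean t - v * t\<bar> \<le> C * t\<^sup>2"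
    using cumulant_expansion[OF assms] by metis
  define t0 where "t0 = min \<delta> (v / (2 * C))"
  have t0: "t0 > 0" "t0 \<le> \<delta>" "t0 \<le> v / (2 * C)" using \<delta> C v0 by (auto simp: t0_def)
  show thesis
  proof (rule that[of "v * t0 / 2"])
    show "v * t0 / 2 > 0" using t0 v0 by simp
    fix l assume l: "0 < l" "l < v * t0 / 2"
    let ?t = "2 * l / v"
    have t: "0 < ?t" "?t \<le> t0" using l v0 by (auto simp: field_simps)
    have "C * ?t \<le> C * (v / (2 * C))" using t t0 C by (intro mult_left_mono) auto
    then have "C * ?t \<le> v / 2" using C by simp
    then have "C * ?t * ?t \<le> v / 2 * ?t" using t by (intro mult_right_mono) auto
    moreover have "v / 2 * ?t = l" using v0 by simp
    ultimately have "C * ?t\<^sup>2 \<le> l" by (simp only: power2_eq_square mult.assoc)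
    moreover have "v * ?t = 2 * l" using v0 by simp
    ultimately have "l \<le> tilted_mean ?t" using m[of ?t] t t0 by auto
    moreover have "continuous_on {0..?t} tilted_mean"
    proof (rule DERIV_continuous_on)
      fix x assume "x \<in> {0..?t}"
      then have "\<bar>x\<bar> < r" using t t0 \<delta> by auto
      then show "(tilted_mean has_real_derivative tilted_variance x) (at x within {0..?t})"
        using has_derivative_tilted_mean has_field_derivative_at_within by blast
    qed
    ultimately obtain t where "0 \<le> t" "t \<le> ?t" "tilted_mean t = l"
      using IVT'[of tilted_mean 0 l ?t] l t by (auto simp: tilted_mean_0 mean)
    moreover from this l have "t \<noteq> 0" by (auto simp: tilted_mean_0 mean)
    ultimately show "\<exists>t. 0 < t \<and> t \<le> ?t \<and> tilted_mean t = l"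
      by (intro exI[of _ t]) auto
  qed
qed

text \<open>
  The first growth condition makes \<open>y\<close> tend to infinity. The second makes \<open>y n\<^bsup>-1/8\<^esup>\<close> tend to 0, so that the normal approximation is accurate enough, and it implies
  \<open>n l\<^sub>n\<^sup>3 \<rightarrow> 0\<close>, so that the rate function may be replaced by its quadratic part.
\<close>

theorem moderate_deviation_upper_tail:
  fixes l :: "nat \<Rightarrow> real"
  assumes mean: "expectation Y = 0" and \<sigma>: "\<sigma> > 0" "\<sigma>\<^sup>2 = variance Y"
    and l_pos: "eventually (\<lambda>n. l n > 0) sequentially"
    and l_large: "filterlim (\<lambda>n. l n * sqrt n) at_top sequentially"
    and l_small: "(\<lambda>n. l n * n powr (3/8)) \<longlonglongrightarrow> 0"
  shows "(\<lambda>n. upper_tail n (l n) / (\<sigma> / (sqrt (2 * pi * n) * l n) * exp (- (n * (l n)\<^sup>2 / (2 * \<sigma>\<^sup>2))))) \<longlonglongrightarrow> 1"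
proof -
  let ?v = "\<sigma>\<^sup>2"
  have v: "tilted_variance 0 = ?v" "?v > 0"
    by (simp only: tilted_variance_0 \<sigma>(2)) (rule zero_less_power[OF \<sigma>(1)])
  obtain C \<delta> where C: "C > 0" and \<delta>: "0 < \<delta>" "\<delta> < r"
    and q: "\<And>t. 0 \<le> t \<Longrightarrow> t \<le> \<delta> \<Longrightarrow>
      \<bar>t * tilted_mean t - log_mgf t - (tilted_mean t)\<^sup>2 / (2 * ?v)\<bar> \<le> C * t ^ 3"
    using cumulant_expansion[OF mean v] by metis
  obtain l0 where l0: "l0 > 0"
    and ex: "\<And>x. 0 < x \<Longrightarrow> x < l0 \<Longrightarrow> \<exists>t. 0 < t \<and> t \<le> 2 * x / ?v \<and> tilted_mean t = x"
    using saddle_point_exists[OF mean v] by metis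
  have l_0: "l \<longlonglongrightarrow> 0"
  proof (rule Lim_transform_eventually)
    have "(\<lambda>n. real n powr (- (3/8))) \<longlonglongrightarrow> 0" by real_asymp
    from tendsto_mult[OF l_small this]
    show "(\<lambda>n. l n * real n powr (3/8) * real n powr (- (3/8))) \<longlonglongrightarrow> 0" by simp
    show "eventually (\<lambda>n. l n * real n powr (3/8) * real n powr (- (3/8)) = l n) sequentially"
      using eventually_gt_at_top[of 0] by eventually_elim (simp add: powr_minus)
  qed
  define t where "t n = (SOME t. 0 < t \<and> t \<le> 2 * l n / ?v \<and> tilted_mean t = l n)" for n
  have "eventually (\<lambda>n. 0 < t n \<and> t n \<le> 2 * l n / ?v \<and> tilted_mean (t n) = l n) sequentially"
    using l_pos order_tendstoD(2)[OF l_0 l0]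
  proof eventually_elim
    case (elim n)
    then show ?case unfolding t_def by (intro someI_ex[OF ex])
  qed
  then have t_pos: "eventually (\<lambda>n. 0 < t n) sequentially"
    and t_le: "eventually (\<lambda>n. t n \<le> 2 * l n / ?v) sequentially"
    and t_mean: "eventually (\<lambda>n. tilted_mean (t n) = l n) sequentially"
    by (auto elim: eventually_mono)
  have t_0: "t \<longlonglongrightarrow> 0"
  proof (rule tendsto_sandwich)
    show "eventually (\<lambda>n. 0 \<le> t n) sequentially" using t_pos by (auto elim: eventually_mono)
    show "eventually (\<lambda>n. t n \<le> 2 * l n / ?v) sequentially" by (rule t_le)
    have "(\<lambda>n. 2 * l n / ?v) \<longlonglongrightarrow> 2 * 0 / ?v" using v(2) by (intro tendsto_intros l_0) auto
    then show "(\<lambda>n. 2 * l n / ?v) \<longlonglongrightarrow> 0" by simp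
  qed simp
  have t_small: "eventually (\<lambda>n. t n \<le> \<delta>) sequentially"
    using order_tendstoD(2)[OF t_0 \<delta>(1)] by (auto elim: eventually_mono)
  have r0: "\<bar>0\<bar> < r" using r_pos by simp
  have var_lim: "(\<lambda>n. tilted_variance (t n)) \<longlonglongrightarrow> ?v"
  proof -
    obtain D where "(tilted_variance has_real_derivative D) (at 0)"
      using tilted_variance_differentiable[OF r0] by auto
    from isCont_tendsto_compose[OF DERIV_isCont[OF this] t_0] show ?thesis unfolding v(1) .
  qed
  have mgf_lim: "(\<lambda>n. mgf_deriv 0 (t n)) \<longlonglongrightarrow> 1"
    using isCont_tendsto_compose[OF DERIV_isCont[OF has_derivative_mgf_deriv[OF r0, of 0]] t_0] by simp
  have mean_lim: "(\<lambda>n. tilted_mean (t n)) \<longlonglongrightarrow> 0"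
    using isCont_tendsto_compose[OF DERIV_isCont[OF has_derivative_tilted_mean[OF r0]] t_0]
    by (simp add: tilted_mean_0 mean)
  have ratio: "(\<lambda>n. l n / t n) \<longlonglongrightarrow> ?v"
  proof (rule Lim_transform_eventually)
    have "((\<lambda>h. tilted_mean h / h) \<longlongrightarrow> ?v) (at 0)"
      using has_derivative_tilted_mean[OF r0] unfolding DERIV_def v(1) by (simp add: tilted_mean_0 mean)
    moreover have "filterlim t (at 0) sequentially"
      using t_0 t_pos by (auto simp: filterlim_at elim: eventually_mono)
    ultimately show "(\<lambda>n. tilted_mean (t n) / t n) \<longlonglongrightarrow> ?v"
      by (rule filterlim_compose)
    show "eventually (\<lambda>n. tilted_mean (t n) / t n = l n / t n) sequentially"
      using t_mean by eventually_elim simp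
  qed
  define s where "s n = sqrt (tilted_variance (t n))" for n
  have s_lim: "s \<longlonglongrightarrow> \<sigma>"
    unfolding s_def using tendsto_real_sqrt[OF var_lim] \<sigma>(1) by simp
  have s_pos: "eventually (\<lambda>n. s n > 0) sequentially"
    using order_tendstoD(1)[OF s_lim \<sigma>(1)] .
  define y where "y n = t n * s n * sqrt (real n)" for n
  \<comment> \<open>In terms of the threshold, \<open>t n\<close> is asymptotic to \<open>l n / \<sigma>\<^sup>2\<close>, so \<open>y n\<close> is of the order \<open>l n * sqrt n\<close>.\<close>
  have inv_ratio: "(\<lambda>n. t n / l n) \<longlonglongrightarrow> 1 / ?v"
    using tendsto_divide[OF tendsto_const[of 1] ratio] v(2) by simp
  have y_eq: "eventually (\<lambda>n. y n = t n / l n * s n * (l n * sqrt (real n))) sequentially"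
    using l_pos by eventually_elim (simp add: y_def)
  have ts_lim: "(\<lambda>n. t n / l n * s n) \<longlonglongrightarrow> 1 / ?v * \<sigma>"
    by (intro tendsto_mult inv_ratio s_lim)
  have y_lim: "filterlim y at_top sequentially"
  proof -
    have "filterlim (\<lambda>n. t n / l n * s n * (l n * sqrt (real n))) at_top sequentially"
      using \<sigma>(1) by (intro filterlim_tendsto_pos_mult_at_top[OF ts_lim _ l_large]) simp
    then show ?thesis using filterlim_cong[OF refl refl y_eq] by simp
  qed
  have y_small: "(\<lambda>n. y n * n powr (- (1/8))) \<longlonglongrightarrow> 0"
  proof (rule Lim_transform_eventually)
    have "(\<lambda>n. t n / l n * s n * (l n * n powr (3/8))) \<longlonglongrightarrow> 1 / ?v * \<sigma> * 0"
      by (intro tendsto_mult ts_lim l_small)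
    then show "(\<lambda>n. t n / l n * s n * (l n * n powr (3/8))) \<longlonglongrightarrow> 0" by simp
    show "eventually (\<lambda>n. t n / l n * s n * (l n * n powr (3/8)) = y n * n powr (- (1/8))) sequentially"
      using y_eq eventually_gt_at_top[of 0]
    proof eventually_elim
      case (elim n)
      have "sqrt (real n) * n powr (- (1/8)) = n powr (3/8)"
        using elim(2) by (simp add: powr_half_sqrt[symmetric] powr_add[symmetric])
      then show ?case unfolding elim(1) by (simp add: mult.assoc)
    qed
  qed
  let ?A = "\<lambda>n. y n * sqrt (2 * pi) * (upper_tail n (tilted_mean (t n)) * exp (n * (t n * tilted_mean (t n) - log_mgf (t n))))"
  have main: "?A \<longlonglongrightarrow> 1"
  proof -
    let ?B = "\<lambda>n. 1 / (y n)\<^sup>2 + 2 * sqrt (2 * pi) * (4 * third_moment_bound \<delta> (t n) + 10) * (y n * n powr (- (1/8)))"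
    let ?a = "\<integral>x. \<bar>Y x\<bar> ^ 3 * exp (\<delta> * \<bar>Y x\<bar>) \<partial>M"
    have tm: "(\<lambda>n. third_moment_bound \<delta> (t n)) \<longlonglongrightarrow> 8 * (?a / 1 + \<bar>0\<bar> ^ 3) / \<sigma> ^ 3"
      unfolding third_moment_bound_def s_def[symmetric]
      using \<sigma>(1) by (intro tendsto_intros mgf_lim mean_lim s_lim) auto
    have y2: "(\<lambda>n. 1 / (y n)\<^sup>2) \<longlonglongrightarrow> 0"
      using tendsto_power[OF tendsto_inverse_0_at_top[OF y_lim], of 2]
      by (simp only: inverse_eq_divide power_one_over zero_power2)
    have B_lim: "?B \<longlonglongrightarrow> 0"
      using tendsto_add[OF y2 tendsto_mult[OF tendsto_mult[OF tendsto_const[of "2 * sqrt (2 * pi)"]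
          tendsto_add[OF tendsto_mult[OF tendsto_const[of 4] tm] tendsto_const[of 10]]] y_small]]
      by simp
    have "eventually (\<lambda>n. norm (?A n - 1) \<le> ?B n) sequentially"
      using t_pos t_small s_pos eventually_ge_at_top[of 1]
    proof eventually_elim
      case (elim n)
      then have "tilted_variance (t n) > 0" by (simp add: s_def)
      from upper_tail_estimate[OF elim(1,2) \<delta>(2) this elim(4)]
      show ?case unfolding y_def s_def by simp
    qed
    from Lim_null_comparison[OF this B_lim] show ?thesis by (rule LIM_zero_cancel)
  qed
  define e where "e n = n * (t n * tilted_mean (t n) - log_mgf (t n) - (tilted_mean (t n))\<^sup>2 / (2 * ?v))" for n
  have e_lim: "e \<longlonglongrightarrow> 0"
  proof (rule Lim_null_comparison)
    show "eventually (\<lambda>n. norm (e n) \<le> C * (t n / l n) ^ 3 * (l n * n powr (3/8)) ^ 3) sequentially"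
      using t_pos t_small l_pos eventually_ge_at_top[of 1]
    proof eventually_elim
      case (elim n)
      have "norm (e n) = n * \<bar>t n * tilted_mean (t n) - log_mgf (t n) - (tilted_mean (t n))\<^sup>2 / (2 * ?v)\<bar>"
        by (simp add: e_def abs_mult)
      also have "\<dots> \<le> n * (C * t n ^ 3)" using elim by (intro mult_left_mono q) auto
      also have "\<dots> = C * (t n / l n) ^ 3 * (l n) ^ 3 * n powr 1"
        using elim by (simp add: power_divide)
      \<comment> \<open>Raising \<open>n\<close> to \<open>9/8\<close> is wasteful but expresses the bound through \<open>l n * n powr (3/8)\<close>.\<close>
      also have "\<dots> \<le> C * (t n / l n) ^ 3 * (l n) ^ 3 * n powr (9/8)"
        using elim C by (intro mult_left_mono powr_mono) auto
      also have "\<dots> = C * (t n / l n) ^ 3 * (l n * n powr (3/8)) ^ 3"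
        using elim by (simp add: power_mult_distrib powr_power)
      finally show ?case .
    qed
    have "(\<lambda>n. C * (t n / l n) ^ 3 * (l n * n powr (3/8)) ^ 3) \<longlonglongrightarrow> C * (1 / ?v) ^ 3 * 0 ^ 3"
      by (intro tendsto_mult tendsto_power inv_ratio l_small tendsto_const)
    then show "(\<lambda>n. C * (t n / l n) ^ 3 * (l n * n powr (3/8)) ^ 3) \<longlonglongrightarrow> 0" by simp
  qed
  \<comment> \<open>The quotient is the normalized tail, times the error in the rate function, times the ratio of \<open>l \<surd>n\<close> to \<open>\<sigma> y\<close>.\<close>
  have "(\<lambda>n. ?A n * exp (- e n) * (l n / t n / (\<sigma> * s n))) \<longlonglongrightarrow> 1 * exp (- 0) * (?v / (\<sigma> * \<sigma>))"
    using \<sigma>(1) by (intro tendsto_mult main tendsto_exp tendsto_minus e_lim tendsto_divide ratio tendsto_const s_lim) auto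
  also have "1 * exp (- 0) * (?v / (\<sigma> * \<sigma>)) = 1" using \<sigma>(1) by (simp add: power2_eq_square)
  finally have lim: "(\<lambda>n. ?A n * exp (- e n) * (l n / t n / (\<sigma> * s n))) \<longlonglongrightarrow> 1" .
  show ?thesis
  proof (rule Lim_transform_eventually[OF lim])
    show "eventually (\<lambda>n. ?A n * exp (- e n) * (l n / t n / (\<sigma> * s n))
        = upper_tail n (l n) / (\<sigma> / (sqrt (2 * pi * n) * l n) * exp (- (n * (l n)\<^sup>2 / (2 * \<sigma>\<^sup>2))))) sequentially"
      using t_pos l_pos s_pos t_mean eventually_ge_at_top[of 1]
    proof eventually_elim
      case (elim n)
      define E where "E = n * (t n * l n - log_mgf (t n))"
      have "exp E * exp (- e n) = exp (n * (l n)\<^sup>2 / (2 * ?v))"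
        unfolding exp_add[symmetric] E_def e_def elim(4) by (simp add: algebra_simps)
      then have exps: "exp E * exp (- e n) = 1 / exp (- (n * (l n)\<^sup>2 / (2 * ?v)))"
        by (simp only: exp_minus inverse_eq_divide) simp
      have "?A n * exp (- e n) * (l n / t n / (\<sigma> * s n))
          = upper_tail n (l n) * (exp E * exp (- e n)) * (y n * sqrt (2 * pi) * (l n / t n / (\<sigma> * s n)))"
        unfolding elim(4) E_def by (simp only: mult_ac)
      also have "y n * sqrt (2 * pi) * (l n / t n / (\<sigma> * s n)) = sqrt (2 * pi * n) * l n / \<sigma>"
        using elim \<sigma>(1) by (simp add: y_def real_sqrt_mult)
      finally show ?case unfolding exps by simp
    qed
  qed
qed

end

section \<open>Two-sided moderate deviations of the sample mean\<close>

text \<open>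
  If convergence were not uniform, choosing a bad point wherever there is one would give a sequence
  along which the limit fails.
\<close>

lemma uniform_limit_zero_sequentially:
  fixes \<epsilon> :: "nat \<Rightarrow> 'a \<Rightarrow> real"
  assumes seq: "\<And>a. (\<And>n. a n \<in> K) \<Longrightarrow> (\<lambda>n. \<epsilon> n (a n)) \<longlonglongrightarrow> 0"
  shows "uniform_limit K \<epsilon> (\<lambda>_. 0) sequentially"
proof (cases "K = {}")
  case False
  then obtain k where k: "k \<in> K" by auto
  show ?thesis
  proof (rule uniform_limitI)
    fix e :: real assume e: "e > 0"
    define a where "a n = (if \<exists>x\<in>K. \<not> dist (\<epsilon> n x) 0 < e then SOME x. x \<in> K \<and> \<not> dist (\<epsilon> n x) 0 < e else k)" for n
    have bad: "a n \<in> K \<and> \<not> dist (\<epsilon> n (a n)) 0 < e" if "\<exists>x\<in>K. \<not> dist (\<epsilon> n x) 0 < e" for n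
      using that someI_ex[of "\<lambda>x. x \<in> K \<and> \<not> dist (\<epsilon> n x) 0 < e"] unfolding a_def by auto
    have "a n \<in> K" for n using bad[of n] k by (cases "\<exists>x\<in>K. \<not> dist (\<epsilon> n x) 0 < e") (auto simp: a_def)
    from tendstoD[OF seq[OF this] e]
    show "eventually (\<lambda>n. \<forall>x\<in>K. dist (\<epsilon> n x) 0 < e) sequentially"
      by eventually_elim (use bad in blast)
  qed
qed simp

text \<open>
  Covers at once the observation itself, its deviation from \<open>c\<close>, and the reflected deviation.
\<close>

lemma exponential_moments_affine:
  assumes D: "prob_space D" "sets D = sets borel" and cgf: "cgf_exists_near_0 D" and s: "\<bar>s\<bar> = 1"
  obtains r where "exponential_moments D (\<lambda>x. s * (x - c)) r"
proof -
  interpret prob_space D by (rule D)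
  note [measurable_cong] = D(2)
  obtain d where d: "d > 0" "\<And>t. \<bar>t\<bar> < d \<Longrightarrow> integrable D (\<lambda>x. exp (t * x))"
    using cgf unfolding cgf_exists_near_0_def eventually_nhds_metric by (auto simp: dist_real_def)
  define r where "r = d / 2"
  have r: "r > 0" "\<bar>r\<bar> < d" "\<bar>-r\<bar> < d" using d by (auto simp: r_def)
  have "integrable D (\<lambda>x. exp (r * \<bar>s * (x - c)\<bar>))"
  proof (rule Bochner_Integration.integrable_bound)
    show "integrable D (\<lambda>x. exp (r * \<bar>c\<bar>) * (exp (r * x) + exp (- r * x)))"
      using d(2)[OF r(2)] d(2)[OF r(3)] by simp
    have "exp (r * \<bar>s * (x - c)\<bar>) \<le> exp (r * \<bar>c\<bar>) * (exp (r * x) + exp (- r * x))" for x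
    proof -
      have "exp (r * \<bar>s * (x - c)\<bar>) = exp (r * \<bar>x - c\<bar>)" using s by (simp add: abs_mult)
      also have "\<dots> \<le> exp (r * \<bar>c\<bar> + r * \<bar>x\<bar>)"
        using mult_left_mono[of "\<bar>x - c\<bar>" "\<bar>c\<bar> + \<bar>x\<bar>" r] r by (simp add: distrib_left)
      also have "\<dots> \<le> exp (r * \<bar>c\<bar>) * (exp (r * x) + exp (- r * x))"
        unfolding exp_add by (intro mult_left_mono) (auto simp: abs_if add_increasing add_increasing2)
      finally show ?thesis .
    qed
    then show "AE x in D. norm (exp (r * \<bar>s * (x - c)\<bar>)) \<le> norm (exp (r * \<bar>c\<bar>) * (exp (r * x) + exp (- r * x)))"
      by (intro AE_I2) simp
  qed measurable
  then have "exponential_moments D (\<lambda>x. s * (x - c)) r"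
    using r by unfold_locales auto
  then show thesis by (rule that)
qed

lemma cgf_second_derivative:
  assumes D: "prob_space D" "sets D = sets borel" and cgf: "cgf_exists_near_0 D"
  shows "deriv (deriv (cgf D)) 0 = prob_space.variance D (\<lambda>x. x)"
proof -
  obtain r where "exponential_moments D (\<lambda>x. 1 * (x - 0)) r"
    using exponential_moments_affine[OF D cgf, of 1 0] by auto
  then interpret exponential_moments D "\<lambda>x. x" r by simp
  have cgf_eq: "cgf D = log_mgf"
    by (simp add: cgf_def log_mgf_def mgf_deriv_def fun_eq_iff)
  have "eventually (\<lambda>t. t \<in> {-r<..<r}) (nhds 0)"
    using r_pos by (intro eventually_nhds_in_open) auto
  then have "eventually (\<lambda>t. deriv (cgf D) t = tilted_mean t) (nhds 0)"
  proof eventually_elim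
    case (elim t)
    then have "\<bar>t\<bar> < r" by auto
    then show ?case unfolding cgf_eq by (intro DERIV_imp_deriv has_derivative_log_mgf)
  qed
  then have "deriv (deriv (cgf D)) 0 = deriv tilted_mean 0"
    by (rule deriv_cong_ev) simp
  also have "\<dots> = tilted_variance 0"
    using r_pos by (intro DERIV_imp_deriv has_derivative_tilted_mean) simp
  finally show ?thesis unfolding tilted_variance_0 .
qed

definition gaussian_tail_main_term :: "real \<Rightarrow> nat \<Rightarrow> real \<Rightarrow> real" where
  "gaussian_tail_main_term \<sigma> n l = \<sigma> / (sqrt (2 * pi * n) * l) * exp (- (n * l\<^sup>2 / (2 * \<sigma>\<^sup>2)))"

text \<open>
  For \<open>l\<^sub>n > 0\<close> the event is the disjoint union of an upper tail of \<open>X - \<theta>\<close> and one of \<open>\<theta> - X\<close>, and these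
  have the same variance.
\<close>

lemma two_sided_moderate_deviation:
  fixes l :: "nat \<Rightarrow> real"
  assumes D: "prob_space D" "sets D = sets borel" and cgf: "cgf_exists_near_0 D"
    and mean: "prob_space.expectation D (\<lambda>x. x) = \<theta>"
    and \<sigma>: "\<sigma> > 0" "\<sigma>\<^sup>2 = prob_space.variance D (\<lambda>x. x)"
    and l_pos: "eventually (\<lambda>n. l n > 0) sequentially"
    and l_large: "filterlim (\<lambda>n. l n * sqrt n) at_top sequentially"
    and l_small: "(\<lambda>n. l n * n powr (3/8)) \<longlonglongrightarrow> 0"
  shows "(\<lambda>n. measure (sample_distr n D) {X \<in> space (sample_distr n D). \<bar>sample_mean n X - \<theta>\<bar> > l n}
      / (2 * gaussian_tail_main_term \<sigma> n (l n))) \<longlonglongrightarrow> 1"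
proof -
  interpret D: prob_space D by (rule D)
  note [measurable_cong] = D(2)
  obtain r where "exponential_moments D (\<lambda>x. 1 * (x - \<theta>)) r"
    using exponential_moments_affine[OF D cgf, of 1 \<theta>] by auto
  then interpret up: exponential_moments D "\<lambda>x. x - \<theta>" r by simp
  obtain r' where "exponential_moments D (\<lambda>x. (-1) * (x - \<theta>)) r'"
    using exponential_moments_affine[OF D cgf, of "-1" \<theta>] by auto
  then interpret down: exponential_moments D "\<lambda>x. \<theta> - x" r' by simp
  have int: "integrable D (\<lambda>x. x)"
    using Bochner_Integration.integrable_add[OF up.integrable_power_exp[of 0 1] D.integrable_const[of \<theta>]] up.r_pos
    by simp
  have m: "D.expectation (\<lambda>x. x - \<theta>) = 0" "D.expectation (\<lambda>x. \<theta> - x) = 0"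
    using int mean by (simp_all add: D.prob_space)
  have v: "\<sigma>\<^sup>2 = D.variance (\<lambda>x. x - \<theta>)" "\<sigma>\<^sup>2 = D.variance (\<lambda>x. \<theta> - x)"
    unfolding m \<sigma>(2) mean by (simp_all add: power2_commute)
  note lims = up.moderate_deviation_upper_tail[OF m(1) \<sigma>(1) v(1) l_pos l_large l_small]
    down.moderate_deviation_upper_tail[OF m(2) \<sigma>(1) v(2) l_pos l_large l_small]
  let ?g = "\<lambda>n. gaussian_tail_main_term \<sigma> n (l n)"
  have "(\<lambda>n. (up.upper_tail n (l n) / ?g n + down.upper_tail n (l n) / ?g n) / 2) \<longlonglongrightarrow> (1 + 1) / 2"
    using lims unfolding gaussian_tail_main_term_def by (intro tendsto_intros) auto
  then have lim: "(\<lambda>n. (up.upper_tail n (l n) / ?g n + down.upper_tail n (l n) / ?g n) / 2) \<longlonglongrightarrow> 1"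
    by simp
  show ?thesis
  proof (rule Lim_transform_eventually[OF lim])
    show "eventually (\<lambda>n. (up.upper_tail n (l n) / ?g n + down.upper_tail n (l n) / ?g n) / 2
        = measure (sample_distr n D) {X \<in> space (sample_distr n D). \<bar>sample_mean n X - \<theta>\<bar> > l n} / (2 * ?g n)) sequentially"
      using l_pos eventually_ge_at_top[of 1]
    proof eventually_elim
      case (elim n)
      let ?P = "PiM {1..n} (\<lambda>_. D)"
      let ?U = "{X \<in> space ?P. (\<Sum>i=1..n. X i - \<theta>) > real n * l n}"
      let ?L = "{X \<in> space ?P. (\<Sum>i=1..n. \<theta> - X i) > real n * l n}"
      interpret P: prob_space ?P by (intro prob_space_PiM D)
      have n: "real n > 0" using elim by simp
      have iff: "\<bar>sample_mean n X - \<theta>\<bar> > l n \<longleftrightarrow>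
          (\<Sum>i=1..n. X i - \<theta>) > real n * l n \<or> (\<Sum>i=1..n. \<theta> - X i) > real n * l n" for X
      proof -
        have "(\<Sum>i=1..n. X i - \<theta>) = n * (sample_mean n X - \<theta>)"
          "(\<Sum>i=1..n. \<theta> - X i) = n * (\<theta> - sample_mean n X)"
          using n by (simp_all add: sample_mean_def sum_subtractf right_diff_distrib)
        then show ?thesis using n by (simp only: mult_less_cancel_left_pos) linarith
      qed
      have disj: "?U \<inter> ?L = {}"
      proof -
        have False if "real n * l n < (\<Sum>i=1..n. X i - \<theta>)" "real n * l n < (\<Sum>i=1..n. \<theta> - X i)" for X
        proof -
          have "(\<Sum>i=1..n. \<theta> - X i) = - (\<Sum>i=1..n. X i - \<theta>)" by (simp add: sum_subtractf)
          moreover have "real n * l n > 0" using n elim(1) by simp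
          ultimately show False using that by linarith
        qed
        then show ?thesis by blast
      qed
      have "{X \<in> space ?P. \<bar>sample_mean n X - \<theta>\<bar> > l n} = ?U \<union> ?L" using iff by blast
      then have "measure ?P {X \<in> space ?P. \<bar>sample_mean n X - \<theta>\<bar> > l n} = measure ?P ?U + measure ?P ?L"
        using disj by (simp only:) (rule P.finite_measure_Union, measurable)
      then show ?case
        unfolding sample_distr_def up.upper_tail_def down.upper_tail_def
        by (simp add: add_divide_distrib)
    qed
  qed
qed

lemma gaussian_tail_main_term_threshold:
  assumes n: "n \<ge> 2" and a: "a > 0"
  shows "2 * gaussian_tail_main_term \<sigma> n (threshold a n)
    = sqrt 2 * \<sigma> / (a * sqrt (pi * ln (real n))) * real n powr (- (a\<^sup>2 / (2 * \<sigma>\<^sup>2)))"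
proof -
  have ln: "ln (real n) > 0" and n0: "real n > 0" using n by auto
  have "sqrt (2 * pi * n) * threshold a n = a * (sqrt 2 * sqrt (pi * ln n))"
    using ln n0 unfolding threshold_def
    by (simp add: real_sqrt_mult real_sqrt_divide)
  then have "2 * \<sigma> / (sqrt (2 * pi * n) * threshold a n) = (2 / sqrt 2) * \<sigma> / (a * sqrt (pi * ln n))"
    by (simp only:) simp
  then have 1: "2 * \<sigma> / (sqrt (2 * pi * n) * threshold a n) = sqrt 2 * \<sigma> / (a * sqrt (pi * ln n))"
    by (simp only: real_div_sqrt[of 2, simplified])
  have "n * (threshold a n)\<^sup>2 = a\<^sup>2 * ln n"
    using ln n0 by (simp add: threshold_def power_mult_distrib)
  then have 2: "exp (- (n * (threshold a n)\<^sup>2 / (2 * \<sigma>\<^sup>2))) = real n powr (- (a\<^sup>2 / (2 * \<sigma>\<^sup>2)))"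
    using n0 by (simp add: powr_def)
  show ?thesis
    unfolding gaussian_tail_main_term_def 1[symmetric] 2[symmetric] by simp
qed

text \<open>
  A compact subset of the positive reals lies in some \<open>[b, c]\<close> with \<open>b > 0\<close>, so \<open>threshold (a n) n\<close> is of
  exact order \<open>\<surd>(log n / n)\<close>, whatever the sequence \<open>a\<close>.
\<close>

lemma threshold_sequence:
  assumes a: "\<And>n. a n \<in> K" and K: "compact K" "K \<subseteq> {0<..}"
  shows "eventually (\<lambda>n. threshold (a n) n > 0) sequentially"
    and "filterlim (\<lambda>n. threshold (a n) n * sqrt n) at_top sequentially"
    and "(\<lambda>n. threshold (a n) n * n powr (3/8)) \<longlonglongrightarrow> 0"
proof -
  have "K \<noteq> {}" using a by auto
  obtain b where b: "b \<in> K" "\<And>x. x \<in> K \<Longrightarrow> b \<le> x" using compact_attains_inf[OF K(1) \<open>K \<noteq> {}\<close>] by blast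
  obtain c where c: "\<And>x. x \<in> K \<Longrightarrow> x \<le> c" using compact_attains_sup[OF K(1) \<open>K \<noteq> {}\<close>] by blast
  have b0: "b > 0" using b K by auto
  have a_bounds: "b \<le> a n" "a n \<le> c" "0 < a n" for n using a[of n] b(2) c b0 by (auto intro: less_le_trans)
  show "eventually (\<lambda>n. threshold (a n) n > 0) sequentially"
    using eventually_ge_at_top[of 2] by eventually_elim (use a_bounds(3) in \<open>simp add: threshold_def\<close>)
  show "filterlim (\<lambda>n. threshold (a n) n * sqrt n) at_top sequentially"
  proof (rule filterlim_at_top_mono)
    show "filterlim (\<lambda>n. b * (sqrt (ln (real n) / real n) * sqrt (real n))) at_top sequentially"
      using b0 by real_asymp
    show "eventually (\<lambda>n. b * (sqrt (ln (real n) / real n) * sqrt (real n)) \<le> threshold (a n) n * sqrt (real n)) sequentially"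
      using eventually_ge_at_top[of 2]
      by eventually_elim (use a_bounds in \<open>simp add: threshold_def mult.assoc mult_right_mono\<close>)
  qed
  show "(\<lambda>n. threshold (a n) n * n powr (3/8)) \<longlonglongrightarrow> 0"
  proof (rule Lim_null_comparison)
    show "(\<lambda>n. c * (sqrt (ln (real n) / real n) * n powr (3/8))) \<longlonglongrightarrow> 0" by real_asymp
    show "eventually (\<lambda>n. norm (threshold (a n) n * n powr (3/8)) \<le> c * (sqrt (ln (real n) / real n) * n powr (3/8))) sequentially"
      using eventually_ge_at_top[of 2]
    proof eventually_elim
      case (elim n)
      have "a n * (sqrt (ln (real n) / real n) * n powr (3/8)) \<le> c * (sqrt (ln (real n) / real n) * n powr (3/8))"
        using a_bounds elim by (intro mult_right_mono) auto
      then show ?case using a_bounds(3)[of n] elim by (simp add: threshold_def abs_mult mult.assoc)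
    qed
  qed
qed

theorem lemma3p1:
  fixes \<mu> :: "real measure" and \<Theta> :: "real set" and f :: "real \<Rightarrow> real \<Rightarrow> real"
    and P :: "real \<Rightarrow> real measure" and \<theta>\<^sub>0 \<sigma> :: real
  assumes "density_family \<mu> \<Theta> f P"
    and "\<theta>\<^sub>0 \<in> \<Theta>"
    and "prob_space.expectation (P \<theta>\<^sub>0) (\<lambda>x. x) = \<theta>\<^sub>0"
    and "cgf_exists_near_0 (P \<theta>\<^sub>0)"
    and "\<sigma> > 0"
    and "\<sigma>\<^sup>2 = deriv (deriv (cgf (P \<theta>\<^sub>0))) 0"
  shows "\<sigma>\<^sup>2 = prob_space.variance (P \<theta>\<^sub>0) (\<lambda>x. x)
    \<and> (\<exists>\<epsilon> \<delta>. locally_uniform_o1 \<epsilon> \<and> locally_uniform_o1 \<delta> \<and>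
        (\<forall>n\<ge>2. \<forall>a>0.
          measure (sample_distr n (P \<theta>\<^sub>0))
              {X \<in> space (sample_distr n (P \<theta>\<^sub>0)). \<bar>sample_mean n X - \<theta>\<^sub>0\<bar> > threshold a n}
            = 2 * \<sigma> / (sqrt (2 * pi * real n) * threshold a n)
                * exp (- (real n * (threshold a n)\<^sup>2 / (2 * \<sigma>\<^sup>2))) * (1 + \<epsilon> n a)
          \<and> 2 * \<sigma> / (sqrt (2 * pi * real n) * threshold a n)
                * exp (- (real n * (threshold a n)\<^sup>2 / (2 * \<sigma>\<^sup>2))) * (1 + \<epsilon> n a)
            = sqrt 2 * \<sigma> / (a * sqrt (pi * ln (real n)))
                * real n powr (- (a\<^sup>2 / (2 * \<sigma>\<^sup>2))) * (1 + \<delta> n a)))"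
proof -
  interpret density_family \<mu> \<Theta> f P by fact
  let ?D = "P \<theta>\<^sub>0"
  have D: "prob_space ?D" "sets ?D = sets borel"
    using prob_space_P[OF assms(2)] P_eq_density[OF assms(2)] by (simp_all add: sets_dominating)
  have var: "\<sigma>\<^sup>2 = prob_space.variance ?D (\<lambda>x. x)"
    unfolding assms(6) by (rule cgf_second_derivative[OF D assms(4)])
  define p where "p n a = measure (sample_distr n ?D)
    {X \<in> space (sample_distr n ?D). \<bar>sample_mean n X - \<theta>\<^sub>0\<bar> > threshold a n}" for n a
  define M where "M n a = 2 * gaussian_tail_main_term \<sigma> n (threshold a n)" for n a
  define \<epsilon> where "\<epsilon> n a = p n a / M n a - 1" for n a
  have M: "M n a = 2 * \<sigma> / (sqrt (2 * pi * real n) * threshold a n)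
      * exp (- (real n * (threshold a n)\<^sup>2 / (2 * \<sigma>\<^sup>2)))" for n a
    by (simp add: M_def gaussian_tail_main_term_def)
  have M_nz: "M n a \<noteq> 0" if "n \<ge> 2" "a > 0" for n a
    using that assms(5) by (simp add: M threshold_def)
  have "locally_uniform_o1 \<epsilon>"
    unfolding locally_uniform_o1_def
  proof (intro allI impI, elim conjE)
    fix K :: "real set" assume K: "compact K" "K \<subseteq> {0<..}"
    show "uniform_limit K \<epsilon> (\<lambda>_. 0) sequentially"
    proof (rule uniform_limit_zero_sequentially)
      fix a :: "nat \<Rightarrow> real" assume "\<And>n. a n \<in> K"
      from two_sided_moderate_deviation[OF D assms(4,3,5) var threshold_sequence[OF this K]]
      have "(\<lambda>n. p n (a n) / M n (a n)) \<longlonglongrightarrow> 1" unfolding p_def M_def .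
      then show "(\<lambda>n. \<epsilon> n (a n)) \<longlonglongrightarrow> 0" unfolding \<epsilon>_def by (simp add: LIM_zero)
    qed
  qed
  moreover have "p n a = M n a * (1 + \<epsilon> n a)" if "n \<ge> 2" "a > 0" for n a
    using M_nz[OF that] by (simp add: \<epsilon>_def)
  moreover have "M n a = sqrt 2 * \<sigma> / (a * sqrt (pi * ln (real n))) * real n powr (- (a\<^sup>2 / (2 * \<sigma>\<^sup>2)))"
    if "n \<ge> 2" "a > 0" for n a
    unfolding M_def by (rule gaussian_tail_main_term_threshold[OF that])
  ultimately show ?thesis
    using var unfolding p_def[symmetric] M[symmetric] by (intro conjI exI[of _ \<epsilon>]) auto
qed

end
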